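(* Let $\bar\alpha>0$, $\bar\sigma\in(0,1)$, $\varepsilon\in(0,1)$, let $f:\mathbb{R}^{n_x}\times\mathbb{R}^{n_x}\to\mathbb{R}^{n_x}$ be continuous and suppose the following two assumptions hold. (A1) There exist a smooth function $V:\mathbb{R}^{n_x}\to\mathbb{R}$ and $\underline{\alpha}_V,\overline{\alpha}_V,\gamma\in\mathcal{K}_\infty$ such that $\underline{\alpha}_V(|x|)\le V(x)\le\overline{\alpha}_V(|x|)$ for all $x\in\mathbb{R}^{n_x}$ and $$\frac{\partial V}{\partial x}f(x,e)\le-\bar\alpha V(x)+\gamma(|e|)\quad\text{for all }(x,e)\in\mathbb{R}^{n_x}\times\mathbb{R}^{n_x}.$$ (A2) With $\tilde\gamma(s)=\alpha^{-1}(\sigma^{-1}\gamma(s))$ where $\alpha(s)=\bar\alpha s$ and $\sigma=1-\bar\sigma$: for any compact set $S\subset\mathbb{R}^{n_x}\times\mathbb{R}^{n_x}$ there exist $L_1,L_2\in\mathbb{R}_{\ge0}$ such that for all $(x,e)\in S$, $|f(x,e)|\le L_1(|x|+|e|)$ and $\underline{\alpha}_V^{-1}(\tilde\gamma(|e|))\le L_2|e|$. Consider the hybrid system with state $q=(x,e,\eta)\in\mathbb{R}^{n_q}=\mathbb{R}^{n_x}\times\mathbb{R}^{n_x}\times\mathbb{R}$, $$\left.\begin{array}{rcl}\dot x&=&f(x,e)\\ \dot e&=&-f(x,e)\\ \dot\eta&=&-\bar\sigma\bar\alpha\end{array}\right\}\ q\in C,\qquad\left.\begin{array}{rcl}x^+&=&x\\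 e^+&=&0\\ \eta^+&=&1\end{array}\right\}\ q\in D,$$ where $C=\{q:V(x)\le\eta V(x+e)\text{ and }\eta\in[\varepsilon,1]\}$ and $D=D_1\cup D_2$ with $D_1=\{q:V(x)\ge\eta V(x+e)\text{ and }\frac{\partial V}{\partial x}f(x,e)\ge-\bar\sigma\bar\alpha V(x)\}$ and $D_2=\{q:\eta=\varepsilon\}$. Then the set $\mathcal{A}=\{q:(x,e)=0\}$ is semiglobally asymptotically stable (S-GAS) for this system, and solutions to this system have a semiglobal dwell time on $\mathbb{R}^{n_q}\setminus\mathcal{A}$.
   Context: Origin of the model: a static controller is implemented with zero-order-hold devices, $x$ is the plant state, $e$ is the sampling-induced error (held state minus current state), and jumps are transmissions. Function classes. $\gamma:\mathbb{R}_{\ge0}\to\mathbb{R}_{\ge0}$ is of class $\mathcal{K}$ if it is continuous, zero at zero and strictly increasing; of class $\mathcal{K}_\infty$ if in addition unbounded. A continuous $\gamma:\mathbb{R}_{\ge0}^2\to\mathbb{R}_{\ge0}$ is of class $\mathcal{KL}$ if $\gamma(\cdot,t)\in\mathcal{K}$ for each $t\ge0$ and $\gamma(s,\cdot)$ is decreasing to zero for each $s>0$. $\beta:\mathbb{R}_{\ge0}^3\to\mathbb{R}_{\ge0}$ is of class $\mathcal{KLL}$ if $\beta(\cdot,\cdot,t)\in\mathcal{KL}$ and $\beta(\cdot,t,\cdot)\in\mathcal{KL}$ for any $t\ge0$. Distance: $|x|_{\mathcal{A}}=\inf\{|x-y|:y\in\mathcal{A}\}$. Hybrid systems. For $\dot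 q=F(q)$, $q\in C$; $q^+=G(q)$, $q\in D$: a set $E\subset\mathbb{R}_{\ge0}\times\mathbb{Z}_{\ge0}$ is a compact hybrid time domain if $E=\bigcup_{j\in\{0,\dots,J\}}([t_j,t_{j+1}],j)$ for some finite sequence $0=t_0\le t_1\le\dots$; $E$ is a hybrid time domain if for all $(T,J)\in E$, $E\cap([0,T]\times\{0,\dots,J\})$ is a compact hybrid time domain. A hybrid arc is a function $\phi$ on a hybrid time domain $\mathrm{dom}\,\phi$ such that $\phi(\cdot,j)$ is locally absolutely continuous for each $j$. A hybrid arc $\phi$ is a solution if (1) for all $j$ and almost all $t$ with $(t,j)\in\mathrm{dom}\,\phi$: $\phi(t,j)\in C$ and $\dot\phi(t,j)=F(\phi(t,j))$; (2) for $(t,j)\in\mathrm{dom}\,\phi$ with $(t,j+1)\in\mathrm{dom}\,\phi$: $\phi(t,j)\in D$ and $\phi(t,j+1)=G(\phi(t,j))$. Solutions are not required to be unique or complete. Forward invariance: $\mathcal{A}$ is forward invariant if every solution $\phi$ with $\phi(0,0)\in\mathcal{A}$ satisfies $\phi(t,j)\in\mathcal{A}$ for all $(t,j)\in\mathrm{dom}\,\phi$. S-GAS: the closed set $\mathcal{A}$ is semiglobally asymptotically stable if for any $\Delta>0$ there exists $\beta_\Delta\in\mathcal{KLL}$ such that every solution $\phi$ with $|\phi(0,0)|_{\mathcal{A}}\le\Delta$ satisfies $|\phi(t,j)|_{\mathcal{A}}\le\beta_\Delta(|\phi(0,0)|_{\mathcal{A}},t,j)$ for all $(t,j)\in\mathrm{dom}\,\phi$.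 Semiglobal dwell time: for a forward invariant set $\mathcal{A}\subset\mathbb{R}^{n}$, solutions have a semiglobal dwell time on $\mathbb{R}^n\setminus\mathcal{A}$ if for any $\Delta>0$ there exists $\tau(\Delta)>0$ such that for any solution $\phi$ with $|\phi(0,0)|_{\mathcal{A}}\le\Delta$, writing $\mathrm{dom}\,\phi=\bigcup([t_j,t_{j+1}],j)$, and for any two successive jump times $t_j,t_{j+1}$ of $\phi$ (so $j\ge1$ and $(t_{j+1},j+1)\in\mathrm{dom}\,\phi$): if $\phi(t,j)\notin\mathcal{A}$ for all $t\in[t_j,t_{j+1}]$, then $t_{j+1}-t_j\ge\tau(\Delta)$. *)

theory Defs
  imports "HOL-Analysis.Analysis"
begin

section \<open>Comparison functions\<close>

text \<open>Comparison functions are total functions on the reals of which only the restriction to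
  nonnegative arguments matters. Nonnegativity of the values is a consequence of monotonicity
  and of the value at zero.\<close>

definition class_K :: "(real \<Rightarrow> real) \<Rightarrow> bool" where
  "class_K g \<longleftrightarrow> continuous_on {0..} g \<and> g 0 = 0 \<and> strict_mono_on {0..} g"

definition class_K_inf :: "(real \<Rightarrow> real) \<Rightarrow> bool" where
  "class_K_inf g \<longleftrightarrow> class_K g \<and> (\<forall>M. \<exists>s\<ge>0. g s > M)"

text \<open>``Decreasing to zero'' is read as nonincreasing with limit zero, in contrast to the
  ``strictly increasing'' of class K.\<close>

definition class_KL :: "(real \<Rightarrow> real \<Rightarrow> real) \<Rightarrow> bool" where
  "class_KL g \<longleftrightarrow>
     continuous_on ({0..} \<times> {0..}) (\<lambda>(s, t). g s t) \<and>
     (\<forall>t\<ge>0. class_K (\<lambda>s. g s t)) \<and>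
     (\<forall>s>0. antimono_on {0..} (g s) \<and> (g s \<longlongrightarrow> 0) at_top)"

definition class_KLL :: "(real \<Rightarrow> real \<Rightarrow> real \<Rightarrow> real) \<Rightarrow> bool" where
  "class_KLL b \<longleftrightarrow>
     (\<forall>t\<ge>0. class_KL (\<lambda>r s. b r s t) \<and> class_KL (\<lambda>r s. b r t s))"

text \<open>Inverse of a class-\<open>K\<^sub>\<infinity>\<close> function as a function on the nonnegative reals.\<close>

definition K_inv :: "(real \<Rightarrow> real) \<Rightarrow> real \<Rightarrow> real" where
  "K_inv g = the_inv_into {0..} g"


section \<open>Smooth and absolutely continuous functions\<close>

text \<open>In finite dimension, having continuous iterated directional derivatives of order \<open>k\<close>, with
  differentiability at each earlier stage, is the same as being of class \<open>C\<^sup>k\<close>.\<close>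

fun class_C :: "nat \<Rightarrow> ('a::euclidean_space \<Rightarrow> 'b::real_normed_vector) \<Rightarrow> bool" where
  "class_C 0 g \<longleftrightarrow> continuous_on UNIV g"
| "class_C (Suc k) g \<longleftrightarrow>
     (\<forall>x. g differentiable (at x)) \<and> (\<forall>v. class_C k (\<lambda>x. frechet_derivative g (at x) v))"

definition smooth :: "('a::euclidean_space \<Rightarrow> 'b::real_normed_vector) \<Rightarrow> bool" where
  "smooth g \<longleftrightarrow> (\<forall>k. class_C k g)"

text \<open>A set \<open>d\<close> with \<open>d division_of \<Union>d\<close> is a finite family of compact intervals with pairwise
  disjoint interiors; the endpoints of a member \<open>k\<close> are \<open>Inf k\<close> and \<open>Sup k\<close>.\<close>

definition abs_continuous_on :: "real set \<Rightarrow> (real \<Rightarrow> 'a::real_normed_vector) \<Rightarrow> bool" where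
  "abs_continuous_on S g \<longleftrightarrow>
     (\<forall>r>0. \<exists>\<delta>>0. \<forall>d. d division_of \<Union>d \<and> \<Union>d \<subseteq> S \<and> (\<Sum>k\<in>d. Sup k - Inf k) < \<delta> \<longrightarrow>
        (\<Sum>k\<in>d. norm (g (Sup k) - g (Inf k))) < r)"

definition loc_abs_continuous_on :: "real set \<Rightarrow> (real \<Rightarrow> 'a::real_normed_vector) \<Rightarrow> bool" where
  "loc_abs_continuous_on S g \<longleftrightarrow> (\<forall>a b. {a..b} \<subseteq> S \<longrightarrow> abs_continuous_on {a..b} g)"


section \<open>Hybrid systems\<close>

record 's hybrid_system =
  flow_set :: "'s set"
  flow_map :: "'s \<Rightarrow> 's"
  jump_set :: "'s set"
  jump_map :: "'s \<Rightarrow> 's"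

definition compact_hybrid_time_domain :: "(real \<times> nat) set \<Rightarrow> bool" where
  "compact_hybrid_time_domain E \<longleftrightarrow>
     (\<exists>(J::nat) (t::nat \<Rightarrow> real). t 0 = 0 \<and> (\<forall>j\<le>J. t j \<le> t (Suc j)) \<and>
        E = (\<Union>j\<le>J. {t j..t (Suc j)} \<times> {j}))"

definition hybrid_time_domain :: "(real \<times> nat) set \<Rightarrow> bool" where
  "hybrid_time_domain E \<longleftrightarrow>
     E \<subseteq> {0..} \<times> UNIV \<and>
     (\<forall>(T, J)\<in>E. compact_hybrid_time_domain (E \<inter> ({0..T} \<times> {0..J})))"

text \<open>A hybrid arc is given by its domain \<open>E\<close> and a total function \<open>\<phi>\<close> of which only the values
  on \<open>E\<close> matter.\<close>

definition hybrid_arc :: "(real \<times> nat) set \<Rightarrow> (real \<Rightarrow> nat \<Rightarrow> 's::real_normed_vector) \<Rightarrow> bool" where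
  "hybrid_arc E \<phi> \<longleftrightarrow>
     hybrid_time_domain E \<and>
     (\<forall>j. loc_abs_continuous_on {t. (t, j) \<in> E} (\<lambda>t. \<phi> t j))"

definition hybrid_solution ::
    "'s::real_normed_vector hybrid_system \<Rightarrow> (real \<times> nat) set \<Rightarrow> (real \<Rightarrow> nat \<Rightarrow> 's) \<Rightarrow> bool" where
  "hybrid_solution H E \<phi> \<longleftrightarrow>
     hybrid_arc E \<phi> \<and>
     (\<forall>j. AE t in lebesgue. (t, j) \<in> E \<longrightarrow>
        \<phi> t j \<in> flow_set H \<and>
        ((\<lambda>s. \<phi> s j) has_vector_derivative flow_map H (\<phi> t j)) (at t within {s. (s, j) \<in> E})) \<and>
     (\<forall>t j. (t, j) \<in> E \<and> (t, Suc j) \<in> E \<longrightarrow>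
        \<phi> t j \<in> jump_set H \<and> \<phi> t (Suc j) = jump_map H (\<phi> t j))"

definition forward_invariant :: "'s::real_normed_vector hybrid_system \<Rightarrow> 's set \<Rightarrow> bool" where
  "forward_invariant H A \<longleftrightarrow>
     (\<forall>E \<phi>. hybrid_solution H E \<phi> \<and> \<phi> 0 0 \<in> A \<longrightarrow> (\<forall>(t, j)\<in>E. \<phi> t j \<in> A))"

text \<open>Closedness of the set is a prerequisite of the notion and hence part of the definition.\<close>

definition S_GAS :: "'s::real_normed_vector hybrid_system \<Rightarrow> 's set \<Rightarrow> bool" where
  "S_GAS H A \<longleftrightarrow>
     closed A \<and>
     (\<forall>\<Delta>>0. \<exists>\<beta>. class_KLL \<beta> \<and>
        (\<forall>E \<phi>. hybrid_solution H E \<phi> \<and> infdist (\<phi> 0 0) A \<le> \<Delta> \<longrightarrow>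
           (\<forall>(t, j)\<in>E. infdist (\<phi> t j) A \<le> \<beta> (infdist (\<phi> 0 0) A) t (real j))))"

text \<open>Forward invariance is likewise a prerequisite of the notion of dwell time. Jump times are
  the \<open>t\<close> with \<open>(t, j)\<close> and \<open>(t, Suc j)\<close> in the domain, so that \<open>s\<close> and \<open>u\<close> below are the
  endpoints of the flow interval with index \<open>Suc j\<close>, which lies between two jumps.\<close>

definition semiglobal_dwell_time :: "'s::real_normed_vector hybrid_system \<Rightarrow> 's set \<Rightarrow> bool" where
  "semiglobal_dwell_time H A \<longleftrightarrow>
     forward_invariant H A \<and>
     (\<forall>\<Delta>>0. \<exists>\<tau>>0. \<forall>E \<phi>. hybrid_solution H E \<phi> \<and> infdist (\<phi> 0 0) A \<le> \<Delta> \<longrightarrow>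
        (\<forall>j s u. (s, j) \<in> E \<and> (s, Suc j) \<in> E \<and> (u, Suc j) \<in> E \<and> (u, Suc (Suc j)) \<in> E \<and>
           (\<forall>t\<in>{s..u}. \<phi> t (Suc j) \<notin> A) \<longrightarrow> u - s \<ge> \<tau>))"


section \<open>The event-triggered control system\<close>

text \<open>The state is \<open>(x, e, \<eta>)\<close>; the norm on the product type is the Euclidean norm.
  The derivative of \<open>V\<close> at \<open>x\<close> in the direction \<open>v\<close> is \<open>frechet_derivative V (at x) v\<close>.\<close>

definition etc_system ::
    "real \<Rightarrow> real \<Rightarrow> real \<Rightarrow> (real^'n \<Rightarrow> real^'n \<Rightarrow> real^'n) \<Rightarrow> (real^'n \<Rightarrow> real) \<Rightarrow>
     ((real^'n) \<times> (real^'n) \<times> real) hybrid_system" where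
  "etc_system \<alpha>bar \<sigma>bar \<epsilon> f V =
     \<lparr> flow_set = {(x, e, \<eta>). V x \<le> \<eta> * V (x + e) \<and> \<eta> \<in> {\<epsilon>..1}},
       flow_map = (\<lambda>(x, e, \<eta>). (f x e, - f x e, - (\<sigma>bar * \<alpha>bar))),
       jump_set = {(x, e, \<eta>). V x \<ge> \<eta> * V (x + e) \<and>
                     frechet_derivative V (at x) (f x e) \<ge> - (\<sigma>bar * \<alpha>bar * V x)}
                  \<union> {(x, e, \<eta>). \<eta> = \<epsilon>},
       jump_map = (\<lambda>(x, e, \<eta>). (x, 0, 1)) \<rparr>"

definition gamma_tilde :: "real \<Rightarrow> real \<Rightarrow> (real \<Rightarrow> real) \<Rightarrow> real \<Rightarrow> real" where
  "gamma_tilde \<alpha>bar \<sigma>bar \<gamma> s = K_inv (\<lambda>r. \<alpha>bar * r) (inverse (1 - \<sigma>bar) * \<gamma> s)"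

end

theory Submission
  imports Defs
begin

text \<open>
  Put \<open>c = \<sigma>bar \<alpha>bar\<close>. During flow \<open>x + e\<close> is constant and \<open>\<eta>\<close> decreases at rate \<open>c\<close>, so after a jump at
  time \<open>s\<close> membership in the flow set reads
  \<open>V (x t) \<le> (1 - c (t - s)) V (x s) \<le> exp (- c (t - s)) V (x s)\<close>. Hence \<open>V\<close> decays exponentially in
  \<open>t\<close> along every solution, and since \<open>x + e\<close> is the state at the last jump, the error decays as well.
  A jump because of \<open>\<eta> = \<epsilon>\<close> needs the time \<open>(1 - \<epsilon>) / c\<close>. A jump triggered by the derivative of \<open>V\<close>
  forces \<open>\<bar>x\<bar> \<le> L2 \<bar>e\<bar>\<close>, and as \<open>e\<close> starts at zero and moves with speed at most \<open>L1 (\<bar>x\<bar> + \<bar>e\<bar>)\<close>, this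
  takes a time bounded below on compact sets. Outside the origin the dwell time bounds the number
  of jumps by a multiple of the elapsed time, which converts half of the decay in \<open>t\<close> into decay
  in \<open>j\<close>.
\<close>

section \<open>Absolutely continuous functions\<close>

text \<open>The increments from \<open>x\<close> to \<open>v\<close> and from \<open>x\<close> to
  \<open>u\<close> are estimated separately. Since \<open>u \<le> x \<le> v\<close>, the two errors
  add up to exactly \<open>r * (v - u)\<close>, so a tag anywhere inside an interval controls the
  increment over the whole interval.\<close>

lemma norm_vector_derivative_bound_within:
  fixes g :: "real \<Rightarrow> 'a::real_normed_vector"
  assumes "(g has_vector_derivative d) (at x within S)" and "norm (d - w) \<le> K" and "r > 0"
  obtains \<rho> where "\<rho> > 0"
    and "\<And>u v. u \<in> S \<Longrightarrow> v \<in> S \<Longrightarrow> u \<le> x \<Longrightarrow> x \<le> v \<Longrightarrow> x - u < \<rho> \<Longrightarrow> v - x < \<rho> \<Longrightarrow>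
      norm (g v - g u - (v - u) *\<^sub>R w) \<le> (K + r) * (v - u)"
proof -
  obtain \<rho> where "\<rho> > 0"
    and \<rho>: "\<And>y. y \<in> S \<Longrightarrow> norm (y - x) < \<rho> \<Longrightarrow>
      norm (g y - g x - (y - x) *\<^sub>R d) \<le> r * norm (y - x)"
    using assms(1,3) unfolding has_vector_derivative_def has_derivative_within_alt by blast
  have "norm (g v - g u - (v - u) *\<^sub>R w) \<le> (K + r) * (v - u)"
    if "u \<in> S" "v \<in> S" "u \<le> x" "x \<le> v" "x - u < \<rho>" "v - x < \<rho>" for u v
  proof -
    have v: "norm (g v - g x - (v - x) *\<^sub>R d) \<le> r * (v - x)"
      using \<rho>[of v] that by simp
    have u: "norm (g u - g x - (u - x) *\<^sub>R d) \<le> r * (x - u)"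
      using \<rho>[of u] that by simp
    have "g v - g u - (v - u) *\<^sub>R w =
        (g v - g x - (v - x) *\<^sub>R d) - (g u - g x - (u - x) *\<^sub>R d) + (v - u) *\<^sub>R (d - w)"
      by (simp add: algebra_simps)
    also have "norm \<dots> \<le> norm (g v - g x - (v - x) *\<^sub>R d) + norm (g u - g x - (u - x) *\<^sub>R d)
        + norm ((v - u) *\<^sub>R (d - w))"
      by (meson norm_triangle_le norm_triangle_ineq4 add_right_mono order.refl order_trans)
    also have "\<dots> \<le> r * (v - x) + r * (x - u) + (v - u) * K"
      using u v that assms(2) by (auto intro!: add_mono mult_left_mono)
    also have "\<dots> = (K + r) * (v - u)"
      by (simp add: algebra_simps)
    finally show ?thesis .
  qed
  with \<open>\<rho> > 0\<close> that show ?thesis by blast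
qed

text \<open>Outer regularity of Lebesgue measure around the null set of bad times. Openness lets
  \<open>U\<close> serve as the gauge at those times.\<close>

lemma AE_lebesgue_exceptional_open:
  assumes "AE t in lebesgue. P t" and "\<delta> > (0::real)"
  obtains U :: "real set" where "open U" "{t. \<not> P t} \<subseteq> U" "U \<in> lmeasurable" "measure lebesgue U < \<delta>"
proof -
  obtain N where N: "N \<in> null_sets lebesgue" "{t. \<not> P t} \<subseteq> N"
    using assms(1) unfolding eventually_ae_filter by auto
  then obtain U where U: "open U" "N \<subseteq> U" "U - N \<in> lmeasurable" "emeasure lebesgue (U - N) < \<delta>"
    using sets_lebesgue_outer_open[of N \<delta>] assms(2) by blast
  have "emeasure lebesgue U = emeasure lebesgue (U - N)"
    using N U by (metis borel_open emeasure_Diff_null_set sets_completionI_sets sets_lborel)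
  then have e: "emeasure lebesgue U < \<delta>" using U by simp
  then have m: "U \<in> lmeasurable"
    using U(1) by (auto intro!: fmeasurableI less_trans[OF e] simp: borel_open)
  then have "measure lebesgue U < \<delta>"
    using e assms(2) by (simp add: emeasure_eq_measure2 ennreal_less_iff)
  then show ?thesis using that N U m by blast
qed

text \<open>A mean value inequality under derivative information almost everywhere, obtained from a
  fine tagged division. It serves two purposes: \<open>K = 0\<close> says that \<open>g\<close> has
  the increments of an affine function with velocity \<open>w\<close>, and \<open>w = 0\<close>
  turns a speed bound into an increment bound.\<close>

lemma abs_continuous_derivative_bound:
  fixes g :: "real \<Rightarrow> 'a::real_normed_vector"
  assumes ac: "abs_continuous_on {a..b} g" and "a \<le> b" and "K \<ge> 0"
    and ae: "AE t in lebesgue. t \<in> {a..b} \<longrightarrow>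
      (\<exists>d. (g has_vector_derivative d) (at t within {a..b}) \<and> norm (d - w) \<le> K)"
  shows "norm (g b - g a - (b - a) *\<^sub>R w) \<le> K * (b - a)"
proof (rule field_le_epsilon)
  fix e :: real assume "e > 0"
  define r where "r = e / (b - a + 2)"
  have "r > 0" using \<open>e > 0\<close> \<open>a \<le> b\<close> by (simp add: r_def)
  obtain \<delta> where "\<delta> > 0" and \<delta>: "\<And>d. d division_of \<Union>d \<Longrightarrow> \<Union>d \<subseteq> {a..b} \<Longrightarrow>
      (\<Sum>k\<in>d. Sup k - Inf k) < \<delta> \<Longrightarrow> (\<Sum>k\<in>d. norm (g (Sup k) - g (Inf k))) < r"
    using ac \<open>r > 0\<close> unfolding abs_continuous_on_def by meson
  define P where "P t \<longleftrightarrow> (t \<in> {a..b} \<longrightarrow>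
      (\<exists>d. (g has_vector_derivative d) (at t within {a..b}) \<and> norm (d - w) \<le> K))" for t
  \<comment> \<open>The first bound makes absolute continuity applicable; the second keeps the
    exceptional length times \<open>norm w\<close> at most \<open>r\<close>.\<close>
  define \<delta>' where "\<delta>' = min \<delta> (r / (norm w + 1))"
  have "\<delta>' > 0" using \<open>\<delta> > 0\<close> \<open>r > 0\<close> by (simp add: \<delta>'_def add_nonneg_pos)
  obtain U where U: "open U" "{t. \<not> P t} \<subseteq> U" "U \<in> lmeasurable" "measure lebesgue U < \<delta>'"
    using AE_lebesgue_exceptional_open[of P \<delta>'] ae \<open>\<delta>' > 0\<close> unfolding P_def by blast
  have "\<exists>\<rho>>0. \<forall>u v. u \<in> {a..b} \<longrightarrow> v \<in> {a..b} \<longrightarrow> u \<le> t \<longrightarrow> t \<le> v \<longrightarrow> t - u < \<rho> \<longrightarrow> v - t < \<rho> \<longrightarrow>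
      norm (g v - g u - (v - u) *\<^sub>R w) \<le> (K + r) * (v - u)" if "P t" for t
  proof (cases "t \<in> {a..b}")
    case True
    then obtain d where "(g has_vector_derivative d) (at t within {a..b})" "norm (d - w) \<le> K"
      using \<open>P t\<close> P_def by blast
    then show ?thesis
      using norm_vector_derivative_bound_within[of g d t "{a..b}" w K r] \<open>r > 0\<close> by metis
  next
    case False
    \<comment> \<open>Vacuous: two points of \<open>{a..b}\<close> on either side of
      \<open>t\<close> would place \<open>t\<close> in \<open>{a..b}\<close>.\<close>
    then show ?thesis by (intro exI[of _ 1]) auto
  qed
  then obtain \<rho> where \<rho>: "\<And>t. P t \<Longrightarrow> \<rho> t > 0" "\<And>t u v. P t \<Longrightarrow> u \<in> {a..b} \<Longrightarrow> v \<in> {a..b} \<Longrightarrow>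
      u \<le> t \<Longrightarrow> t \<le> v \<Longrightarrow> t - u < \<rho> t \<Longrightarrow> v - t < \<rho> t \<Longrightarrow>
      norm (g v - g u - (v - u) *\<^sub>R w) \<le> (K + r) * (v - u)"
    by metis
  text \<open>Intervals tagged outside the null set are controlled by the derivative, the others have small
    total length and are controlled by absolute continuity.\<close>
  define \<gamma> where "\<gamma> t = (if P t then ball t (\<rho> t) else U)" for t
  have "gauge \<gamma>"
    using U \<rho>(1) by (auto simp: gauge_def \<gamma>_def)
  then obtain p where p: "p tagged_division_of {a..b}" "\<gamma> fine p"
    using fine_division_exists_real by blast
  note tag = tagged_division_ofD[OF p(1)]
  have int: "\<exists>u v. k = {u..v} \<and> u \<le> x \<and> x \<le> v \<and> u \<in> {a..b} \<and> v \<in> {a..b} \<and> Sup k = v \<and> Inf k = u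
      \<and> measure lborel k = v - u" if xk: "(x, k) \<in> p" for x k
  proof -
    obtain u v where "k = {u..v}" using tag(4)[OF xk] by (auto simp: cbox_interval)
    with tag(2,3)[OF xk] show ?thesis
      by (intro exI[of _ u] exI[of _ v]) (auto simp: content_real)
  qed
  define F where "F = (\<lambda>(x::real, k). g (Sup k) - g (Inf k) - measure lborel k *\<^sub>R w)"
  define A where "A = {(x, k) \<in> p. P x}"
  define B where "B = {(x, k) \<in> p. \<not> P x}"
  have split: "p = A \<union> B" "A \<inter> B = {}" "finite A" "finite B"
    using tag(1) by (auto simp: A_def B_def intro: finite_subset[of _ p])
  have cont: "(\<Sum>(x, k)\<in>p. measure lborel k) = b - a"
    using additive_content_tagged_division[of p a b] p(1) \<open>a \<le> b\<close> by (simp add: cbox_interval)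
  have "g b - g a - (b - a) *\<^sub>R w = sum F p"
    using additive_tagged_division_1[OF \<open>a \<le> b\<close> p(1), of g] cont
    by (simp add: F_def case_prod_unfold sum_subtractf flip: scaleR_left.sum)
  also have "\<dots> = sum F A + sum F B"
    using split by (simp add: sum.union_disjoint)
  also have "norm \<dots> \<le> norm (sum F A) + norm (sum F B)"
    by (rule norm_triangle_ineq)
  also have "norm (sum F A) \<le> (K + r) * (b - a)"
  proof -
    have "norm (sum F A) \<le> (\<Sum>(x, k)\<in>A. (K + r) * measure lborel k)"
    proof (rule sum_norm_le, clarify)
      fix x k assume "(x, k) \<in> A"
      then have xk: "(x, k) \<in> p" "P x" by (auto simp: A_def)
      obtain u v where uv: "k = {u..v}" "u \<le> x" "x \<le> v" "u \<in> {a..b}" "v \<in> {a..b}" "Sup k = v"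
        "Inf k = u" "measure lborel k = v - u"
        using int[OF xk(1)] by blast
      have "k \<subseteq> ball x (\<rho> x)" using fineD[OF p(2) xk(1)] xk(2) by (simp add: \<gamma>_def)
      moreover have "u \<in> k" "v \<in> k" using uv(1-3) by auto
      ultimately have "u \<in> ball x (\<rho> x)" "v \<in> ball x (\<rho> x)" by blast+
      then show "norm (F (x, k)) \<le> (K + r) * measure lborel k"
        using \<rho>(2)[of x u v] uv xk by (auto simp: F_def dist_real_def)
    qed
    also have "\<dots> \<le> (\<Sum>(x, k)\<in>p. (K + r) * measure lborel k)"
      using split \<open>K \<ge> 0\<close> \<open>r > 0\<close> tag(1) by (intro sum_mono2) auto
    also have "\<dots> = (K + r) * (b - a)"
      using cont by (simp add: case_prod_unfold flip: sum_distrib_left)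
    finally show ?thesis .
  qed
  also have "norm (sum F B) \<le> 2 * r"
  proof -
    have "B tagged_partial_division_of {a..b}"
      using p(1) split unfolding tagged_division_of_def
      by (metis sup_ge2 tagged_partial_division_subset)
    then have Btag: "B tagged_division_of \<Union>(snd ` B)"
      by (rule tagged_partial_division_of_Union_self)
    then have Bdiv: "snd ` B division_of \<Union>(snd ` B)"
      by (rule division_of_tagged_division)
    have Bp: "B \<subseteq> p" by (auto simp: B_def)
    have sub: "\<Union>(snd ` B) \<subseteq> {a..b}" using Bp tag(3) by force
    have BU: "\<Union>(snd ` B) \<subseteq> U"
    proof (rule UN_least, clarsimp)
      fix x k y assume "(x, k) \<in> B" "y \<in> k"
      then show "y \<in> U" using fineD[OF p(2), of x k] by (auto simp: B_def \<gamma>_def)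
    qed
    have "(\<Sum>k\<in>snd ` B. measure lborel k) = measure lebesgue (\<Union>(snd ` B))"
    proof -
      have "(\<Sum>k\<in>snd ` B. measure lborel k) = (\<Sum>k\<in>snd ` B. measure lebesgue k)"
      proof (rule sum.cong[OF refl])
        fix k assume "k \<in> snd ` B"
        then obtain u v where "k = cbox u v" using division_ofD(4)[OF Bdiv] by blast
        then show "measure lborel k = measure lebesgue k" by simp
      qed
      also have "\<dots> = measure lebesgue (\<Union>(snd ` B))"
        using content_division[OF Bdiv] by simp
      finally show ?thesis .
    qed
    also have "\<dots> \<le> measure lebesgue U"
      by (rule measure_mono_fmeasurable[OF BU fmeasurableD[OF lmeasurable_division[OF Bdiv]] U(3)])
    finally have small: "(\<Sum>k\<in>snd ` B. measure lborel k) < \<delta>'" using U(4) by simp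
    have cB: "(\<Sum>k\<in>snd ` B. measure lborel k) = (\<Sum>k\<in>snd ` B. Sup k - Inf k)"
    proof (rule sum.cong[OF refl])
      fix k assume "k \<in> snd ` B"
      then obtain x where "(x, k) \<in> p" using Bp by auto
      with int[OF this] show "measure lborel k = Sup k - Inf k" by auto
    qed
    \<comment> \<open>Absolute continuity speaks of sets of intervals, so sums over tagged pairs
      must be reindexed. An interval with two different tags would have empty interior, hence be a
      single point, and could not contain both tags.\<close>
    have "inj_on snd B"
    proof (rule inj_onI, clarsimp)
      fix x y k assume "(x, k) \<in> B" "(y, k) \<in> B"
      then have "(x, k) \<in> p" "(y, k) \<in> p" by (auto simp: B_def)
      show "x = y"
      proof (rule ccontr)
        assume "x \<noteq> y"
        then have "interior k = {}"
          using tag(5)[OF \<open>(x, k) \<in> p\<close> \<open>(y, k) \<in> p\<close>] by auto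
        moreover obtain u v where uv: "k = {u..v}" "u \<le> x" "x \<le> v"
          using int[OF \<open>(x, k) \<in> p\<close>] by blast
        ultimately have "v \<le> u" by simp
        then show False using uv tag(2)[OF \<open>(y, k) \<in> p\<close>] \<open>x \<noteq> y\<close> by auto
      qed
    qed
    then have over: "(\<Sum>(x, k)\<in>B. h k) = (\<Sum>k\<in>snd ` B. h k)" for h :: "real set \<Rightarrow> real"
      by (simp add: sum.reindex case_prod_unfold)
    have "norm (sum F B) \<le> (\<Sum>(x, k)\<in>B. norm (g (Sup k) - g (Inf k)) + measure lborel k * norm w)"
    proof (rule sum_norm_le, clarify)
      fix x k
      show "norm (F (x, k)) \<le> norm (g (Sup k) - g (Inf k)) + measure lborel k * norm w"
        using norm_triangle_ineq4[of "g (Sup k) - g (Inf k)" "measure lborel k *\<^sub>R w"]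
        by (simp add: F_def)
    qed
    also have "\<dots> = (\<Sum>k\<in>snd ` B. norm (g (Sup k) - g (Inf k))) + (\<Sum>k\<in>snd ` B. measure lborel k) * norm w"
      using over[of "measure lborel"] over[of "\<lambda>k. norm (g (Sup k) - g (Inf k))"]
      by (simp add: case_prod_unfold sum.distrib flip: sum_distrib_right)
    also have "\<dots> \<le> r + \<delta>' * norm w"
    proof (intro add_mono mult_right_mono norm_ge_zero)
      show "(\<Sum>k\<in>snd ` B. norm (g (Sup k) - g (Inf k))) \<le> r"
        using \<delta>[OF Bdiv sub] small cB by (simp add: \<delta>'_def)
    qed (use small in simp)
    also have "\<delta>' * norm w \<le> r / (norm w + 1) * norm w"
      by (intro mult_right_mono) (auto simp: \<delta>'_def)
    also have "\<dots> \<le> r"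
    proof -
      have "norm w + 1 > 0" by (simp add: add_nonneg_pos)
      with \<open>r > 0\<close> show ?thesis by (simp add: field_simps)
    qed
    finally show ?thesis by simp
  qed
  also have "(K + r) * (b - a) + 2 * r = K * (b - a) + e"
  proof -
    have "r * (b - a + 2) = e" using \<open>a \<le> b\<close> by (simp add: r_def)
    then show ?thesis by (simp add: algebra_simps)
  qed
  finally show "norm (g b - g a - (b - a) *\<^sub>R w) \<le> K * (b - a) + e" by simp
qed

section \<open>Absolute continuity under linear maps, continuity, and closed constraints\<close>

lemma abs_continuous_on_bounded_linear:
  assumes "bounded_linear T" and ac: "abs_continuous_on S g"
  shows "abs_continuous_on S (\<lambda>t. T (g t))"
  unfolding abs_continuous_on_def
proof (intro allI impI)
  interpret bounded_linear T by fact
  fix r :: real assume "r > 0"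
  obtain B where B: "B > 0" "\<And>x. norm (T x) \<le> norm x * B"
    using pos_bounded by blast
  have "r / B > 0" using B \<open>r > 0\<close> by simp
  then obtain \<delta> where "\<delta> > 0" and \<delta>: "\<And>d. d division_of \<Union>d \<and> \<Union>d \<subseteq> S \<and>
      (\<Sum>k\<in>d. Sup k - Inf k) < \<delta> \<Longrightarrow> (\<Sum>k\<in>d. norm (g (Sup k) - g (Inf k))) < r / B"
    using ac unfolding abs_continuous_on_def by meson
  show "\<exists>\<delta>>0. \<forall>d. d division_of \<Union>d \<and> \<Union>d \<subseteq> S \<and> (\<Sum>k\<in>d. Sup k - Inf k) < \<delta> \<longrightarrow>
      (\<Sum>k\<in>d. norm (T (g (Sup k)) - T (g (Inf k)))) < r"
  proof (intro exI[of _ \<delta>] conjI allI impI \<open>\<delta> > 0\<close>)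
    fix d assume d: "d division_of \<Union>d \<and> \<Union>d \<subseteq> S \<and> (\<Sum>k\<in>d. Sup k - Inf k) < \<delta>"
    have "(\<Sum>k\<in>d. norm (T (g (Sup k)) - T (g (Inf k)))) \<le> (\<Sum>k\<in>d. norm (g (Sup k) - g (Inf k)) * B)"
      using B(2) by (intro sum_mono) (simp flip: diff)
    also have "\<dots> = (\<Sum>k\<in>d. norm (g (Sup k) - g (Inf k))) * B"
      by (simp add: sum_distrib_right)
    also have "\<dots> < r"
      using \<delta>[OF d] B(1) by (simp add: field_simps)
    finally show "(\<Sum>k\<in>d. norm (T (g (Sup k)) - T (g (Inf k)))) < r" .
  qed
qed

lemma abs_continuous_on_imp_continuous_on:
  assumes ac: "abs_continuous_on {a..b} g"
  shows "continuous_on {a..b} g"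
  unfolding continuous_on_iff
proof (intro ballI allI impI)
  fix x e :: real assume x: "x \<in> {a..b}" and "e > 0"
  obtain \<delta> where "\<delta> > 0" and \<delta>: "\<And>d. d division_of \<Union>d \<and> \<Union>d \<subseteq> {a..b} \<and>
      (\<Sum>k\<in>d. Sup k - Inf k) < \<delta> \<Longrightarrow> (\<Sum>k\<in>d. norm (g (Sup k) - g (Inf k))) < e"
    using ac \<open>e > 0\<close> unfolding abs_continuous_on_def by meson
  have *: "norm (g v - g u) < e" if "u \<in> {a..b}" "v \<in> {a..b}" "u \<le> v" "v - u < \<delta>" for u v
  proof -
    have "{{u..v}} division_of {u..v}"
      using that division_of_self[of u v] by (simp add: cbox_interval)
    then show ?thesis
      using \<delta>[of "{{u..v}}"] that by auto
  qed
  show "\<exists>d>0. \<forall>x'\<in>{a..b}. dist x' x < d \<longrightarrow> dist (g x') (g x) < e"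
  proof (intro exI[of _ \<delta>] conjI ballI impI \<open>\<delta> > 0\<close>)
    fix y assume y: "y \<in> {a..b}" "dist y x < \<delta>"
    show "dist (g y) (g x) < e"
    proof (cases "x \<le> y")
      case True
      then show ?thesis using *[of x y] x y by (simp add: dist_norm)
    next
      case False
      then show ?thesis using *[of y x] x y by (simp add: dist_norm norm_minus_commute)
    qed
  qed
qed

text \<open>The interior times at which \<open>q\<close> is outside \<open>C\<close> form an open
  null set, which must be empty; continuity adds the endpoints. A one-point interval is itself null,
  hence \<open>a < b\<close>.\<close>

lemma AE_mem_closed_imp_mem:
  fixes q :: "real \<Rightarrow> 'a::topological_space"
  assumes "a < b" and cont: "continuous_on {a..b} q" and "closed C"
    and ae: "AE t in lebesgue. t \<in> {a..b} \<longrightarrow> q t \<in> C"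
    and t: "t \<in> {a..b}"
  shows "q t \<in> C"
proof -
  define S where "S = {a<..<b} \<inter> q -` (- C)"
  have "open S"
    unfolding S_def
    by (intro continuous_open_preimage continuous_on_subset[OF cont] open_Compl \<open>closed C\<close>) auto
  moreover have "negligible S"
  proof -
    obtain N where "N \<in> null_sets lebesgue" "{t. \<not> (t \<in> {a..b} \<longrightarrow> q t \<in> C)} \<subseteq> N"
      using ae unfolding eventually_ae_filter by auto
    moreover from this have "S \<subseteq> N" by (auto simp: S_def)
    ultimately show ?thesis
      using negligible_iff_null_sets negligible_subset by blast
  qed
  ultimately have "S = {}"
    using open_not_negligible by blast
  then have "q ` {a<..<b} \<subseteq> C"
    by (auto simp: S_def)
  then have "q ` closure {a<..<b} \<subseteq> C"
    using \<open>a < b\<close> cont \<open>closed C\<close> by (intro image_closure_subset) auto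
  then show ?thesis
    using \<open>a < b\<close> t by auto
qed

section \<open>Hybrid time domains and solutions\<close>

text \<open>Truncation at \<open>(T, J)\<close> turns membership in \<open>E\<close> into
  inequalities between consecutive endpoints \<open>t j\<close>. The order facts on time domains
  below are all read off such a truncation.\<close>

lemma hybrid_time_domain_slice:
  assumes "hybrid_time_domain E" and "(T, J) \<in> E"
  obtains K and t :: "nat \<Rightarrow> real" where "t 0 = 0" "\<And>j. j \<le> K \<Longrightarrow> t j \<le> t (Suc j)"
    "\<And>s j. s \<le> T \<Longrightarrow> j \<le> J \<Longrightarrow> (s, j) \<in> E \<longleftrightarrow> j \<le> K \<and> t j \<le> s \<and> s \<le> t (Suc j)"
proof -
  have "compact_hybrid_time_domain (E \<inter> ({0..T} \<times> {0..J}))"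
    using assms unfolding hybrid_time_domain_def by fast
  then obtain K and t :: "nat \<Rightarrow> real" where t: "t 0 = 0" "\<And>j. j \<le> K \<Longrightarrow> t j \<le> t (Suc j)"
    and eq: "E \<inter> ({0..T} \<times> {0..J}) = (\<Union>j\<le>K. {t j..t (Suc j)} \<times> {j})"
    unfolding compact_hybrid_time_domain_def by auto
  have nonneg: "s \<ge> 0" if "(s, j) \<in> E" for s j
    using assms(1) that unfolding hybrid_time_domain_def by auto
  have "(s, j) \<in> E \<longleftrightarrow> j \<le> K \<and> t j \<le> s \<and> s \<le> t (Suc j)" if "s \<le> T" "j \<le> J" for s j
  proof -
    have "(s, j) \<in> E \<longleftrightarrow> (s, j) \<in> E \<inter> ({0..T} \<times> {0..J})"
      using that nonneg by auto
    then show ?thesis unfolding eq by auto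
  qed
  with t that show ?thesis by blast
qed

lemma hybrid_time_domain_interval:
  assumes "hybrid_time_domain E" and "(s, j) \<in> E" and "(u, j) \<in> E"
  shows "{s..u} \<times> {j} \<subseteq> E"
proof (rule hybrid_time_domain_slice[OF assms(1,3)])
  fix K and t :: "nat \<Rightarrow> real"
  assume *: "\<And>v i. v \<le> u \<Longrightarrow> i \<le> j \<Longrightarrow> (v, i) \<in> E \<longleftrightarrow> i \<le> K \<and> t i \<le> v \<and> v \<le> t (Suc i)"
  show ?thesis
  proof clarify
    fix v assume v: "v \<in> {s..u}"
    then show "(v, j) \<in> E"
      using *[of s j] *[of u j] *[of v j] assms by auto
  qed
qed

lemma hybrid_time_domain_0:
  assumes "hybrid_time_domain E" and "(u, 0) \<in> E"
  shows "(0, 0) \<in> E" and "0 \<le> u"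
proof -
  show "0 \<le> u" using assms unfolding hybrid_time_domain_def by auto
  show "(0, 0) \<in> E"
  proof (rule hybrid_time_domain_slice[OF assms])
    fix K and t :: "nat \<Rightarrow> real"
    assume "t 0 = 0" and *: "\<And>v i. v \<le> u \<Longrightarrow> i \<le> 0 \<Longrightarrow> (v, i) \<in> E \<longleftrightarrow> i \<le> K \<and> t i \<le> v \<and> v \<le> t (Suc i)"
    then show ?thesis
      using *[of u 0] *[of 0 0] assms(2) \<open>0 \<le> u\<close> by auto
  qed
qed

lemma hybrid_time_domain_jump_time:
  assumes "hybrid_time_domain E" and "(u, Suc j) \<in> E"
  obtains s where "s \<le> u" "(s, j) \<in> E" "(s, Suc j) \<in> E"
proof (rule hybrid_time_domain_slice[OF assms])
  fix K and t :: "nat \<Rightarrow> real"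
  assume mono: "\<And>i. i \<le> K \<Longrightarrow> t i \<le> t (Suc i)"
    and *: "\<And>v i. v \<le> u \<Longrightarrow> i \<le> Suc j \<Longrightarrow> (v, i) \<in> E \<longleftrightarrow> i \<le> K \<and> t i \<le> v \<and> v \<le> t (Suc i)"
  have K: "Suc j \<le> K" "t (Suc j) \<le> u" using *[of u "Suc j"] assms(2) by auto
  have "t (Suc j) \<le> u" "(t (Suc j), j) \<in> E" "(t (Suc j), Suc j) \<in> E"
    using K mono[of j] mono[of "Suc j"] *[of "t (Suc j)" j] *[of "t (Suc j)" "Suc j"] by auto
  then show ?thesis by (rule that)
qed

text \<open>In the truncation at the jump, interval \<open>j\<close> ends where interval
  \<open>Suc j\<close> starts. The jump time is at most this common endpoint, and no point of
  interval \<open>Suc j\<close> precedes it.\<close>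

lemma hybrid_time_domain_jump_le:
  assumes "hybrid_time_domain E" and "(s, j) \<in> E" and "(s, Suc j) \<in> E" and "(u, Suc j) \<in> E"
  shows "s \<le> u"
proof (rule ccontr)
  assume "\<not> s \<le> u"
  show False
  proof (rule hybrid_time_domain_slice[OF assms(1,3)])
    fix K and t :: "nat \<Rightarrow> real"
    assume "\<And>v i. v \<le> s \<Longrightarrow> i \<le> Suc j \<Longrightarrow> (v, i) \<in> E \<longleftrightarrow> i \<le> K \<and> t i \<le> v \<and> v \<le> t (Suc i)"
    from this[of s j] this[of u "Suc j"] \<open>\<not> s \<le> u\<close> assms show False by auto
  qed
qed

section \<open>Flow and jump properties of a hybrid solution\<close>

context
  fixes H :: "'s::real_normed_vector hybrid_system" and E \<phi>
  assumes sol: "hybrid_solution H E \<phi>"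
begin

lemma hybrid_solution_time_domain: "hybrid_time_domain E"
  using sol unfolding hybrid_solution_def hybrid_arc_def by blast

lemma hybrid_solution_jump:
  assumes "(t, j) \<in> E" and "(t, Suc j) \<in> E"
  shows "\<phi> t j \<in> jump_set H" and "\<phi> t (Suc j) = jump_map H (\<phi> t j)"
  using sol assms unfolding hybrid_solution_def by blast+

lemma hybrid_solution_abs_continuous_on:
  assumes "(s, j) \<in> E" and "(u, j) \<in> E"
  shows "abs_continuous_on {s..u} (\<lambda>t. \<phi> t j)"
  using sol hybrid_time_domain_interval[OF hybrid_solution_time_domain assms]
  unfolding hybrid_solution_def hybrid_arc_def loc_abs_continuous_on_def by blast

lemma hybrid_solution_AE:
  assumes "(s, j) \<in> E" and "(u, j) \<in> E"
  shows "AE t in lebesgue. t \<in> {s..u} \<longrightarrow> \<phi> t j \<in> flow_set H \<and>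
    ((\<lambda>t. \<phi> t j) has_vector_derivative flow_map H (\<phi> t j)) (at t within {s..u})"
proof -
  have "AE t in lebesgue. (t, j) \<in> E \<longrightarrow> \<phi> t j \<in> flow_set H \<and>
      ((\<lambda>s. \<phi> s j) has_vector_derivative flow_map H (\<phi> t j)) (at t within {s. (s, j) \<in> E})"
    using sol unfolding hybrid_solution_def by blast
  then show ?thesis
  proof (eventually_elim, intro impI)
    fix t
    assume *: "(t, j) \<in> E \<longrightarrow> \<phi> t j \<in> flow_set H \<and>
      ((\<lambda>s. \<phi> s j) has_vector_derivative flow_map H (\<phi> t j)) (at t within {s. (s, j) \<in> E})"
      and "t \<in> {s..u}"
    moreover have "{s..u} \<subseteq> {s. (s, j) \<in> E}"
      using hybrid_time_domain_interval[OF hybrid_solution_time_domain assms] by auto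
    ultimately show "\<phi> t j \<in> flow_set H \<and>
        ((\<lambda>t. \<phi> t j) has_vector_derivative flow_map H (\<phi> t j)) (at t within {s..u})"
      by (auto intro: has_vector_derivative_within_subset)
  qed
qed

lemma hybrid_solution_mem_flow_set:
  assumes "(s, j) \<in> E" and "(u, j) \<in> E" and "s < u" and "closed (flow_set H)" and "t \<in> {s..u}"
  shows "\<phi> t j \<in> flow_set H"
proof (rule AE_mem_closed_imp_mem[OF \<open>s < u\<close> _ assms(4) _ assms(5)])
  show "continuous_on {s..u} (\<lambda>t. \<phi> t j)"
    by (rule abs_continuous_on_imp_continuous_on[OF hybrid_solution_abs_continuous_on[OF assms(1,2)]])
  show "AE t in lebesgue. t \<in> {s..u} \<longrightarrow> \<phi> t j \<in> flow_set H"
    using hybrid_solution_AE[OF assms(1,2)] by eventually_elim blast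
qed

text \<open>\<open>T\<close> extracts a quantity from the state and \<open>w\<close> is its
  reference velocity. The bound is asked for only at states in the flow set, where the solution is
  at almost every time of the interval.\<close>

lemma hybrid_solution_increment_bound:
  fixes T :: "'s \<Rightarrow> 'b::real_normed_vector"
  assumes "(s, j) \<in> E" and "(u, j) \<in> E" and "s \<le> u" and "bounded_linear T" and "K \<ge> 0"
    and bound: "\<And>t. t \<in> {s..u} \<Longrightarrow> \<phi> t j \<in> flow_set H \<Longrightarrow> norm (T (flow_map H (\<phi> t j)) - w) \<le> K"
  shows "norm (T (\<phi> u j) - T (\<phi> s j) - (u - s) *\<^sub>R w) \<le> K * (u - s)"
proof (rule abs_continuous_derivative_bound[OF _ \<open>s \<le> u\<close> \<open>K \<ge> 0\<close>])
  show "abs_continuous_on {s..u} (\<lambda>t. T (\<phi> t j))"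
    by (rule abs_continuous_on_bounded_linear[OF \<open>bounded_linear T\<close>
          hybrid_solution_abs_continuous_on[OF assms(1,2)]])
  show "AE t in lebesgue. t \<in> {s..u} \<longrightarrow> (\<exists>d. ((\<lambda>t. T (\<phi> t j)) has_vector_derivative d)
      (at t within {s..u}) \<and> norm (d - w) \<le> K)"
    using hybrid_solution_AE[OF assms(1,2)]
  proof (eventually_elim, intro impI exI conjI)
    fix t
    assume *: "t \<in> {s..u} \<longrightarrow> \<phi> t j \<in> flow_set H \<and>
        ((\<lambda>t. \<phi> t j) has_vector_derivative flow_map H (\<phi> t j)) (at t within {s..u})"
      and t: "t \<in> {s..u}"
    show "((\<lambda>t. T (\<phi> t j)) has_vector_derivative T (flow_map H (\<phi> t j))) (at t within {s..u})"
      by (rule bounded_linear.has_vector_derivative[OF \<open>bounded_linear T\<close>]) (use * t in blast)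
    show "norm (T (flow_map H (\<phi> t j)) - w) \<le> K"
      by (rule bound[OF t]) (use * t in blast)
  qed
qed

end

section \<open>Comparison functions\<close>

lemma class_K_nonneg: "class_K g \<Longrightarrow> s \<ge> 0 \<Longrightarrow> g s \<ge> 0"
  unfolding class_K_def by (metis atLeast_iff order_refl strict_mono_on_leD)

lemma class_K_mono: "class_K g \<Longrightarrow> 0 \<le> s \<Longrightarrow> s \<le> s' \<Longrightarrow> g s \<le> g s'"
  unfolding class_K_def by (meson atLeast_iff order_trans strict_mono_on_leD)

lemma class_K_less_iff: "class_K g \<Longrightarrow> 0 \<le> s \<Longrightarrow> 0 \<le> s' \<Longrightarrow> g s < g s' \<longleftrightarrow> s < s'"
  unfolding class_K_def by (metis atLeast_iff linorder_not_less order_less_asym' order_le_less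
      strict_mono_onD)

context
  fixes g :: "real \<Rightarrow> real"
  assumes g: "class_K_inf g"
begin

lemma class_K_inf_imp_class_K: "class_K g"
  using g unfolding class_K_inf_def by blast

text \<open>Surjectivity combines unboundedness with the intermediate value theorem, injectivity is
  strict monotonicity. This makes \<open>K_inv g\<close> a genuine inverse on the nonnegative
  reals.\<close>

lemma class_K_inf_bij_betw: "bij_betw g {0..} {0..}"
proof -
  have "y \<in> g ` {0..}" if y: "y \<ge> 0" for y
  proof -
    obtain s where s: "s \<ge> 0" "g s > y"
      using g unfolding class_K_inf_def by blast
    have "continuous_on {0..s} g"
      using class_K_inf_imp_class_K unfolding class_K_def
      by (metis atLeastAtMost_iff atLeast_iff continuous_on_subset subsetI)
    then obtain x where "0 \<le> x" "x \<le> s" "g x = y"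
      using IVT'[of g 0 y s] s y class_K_inf_imp_class_K unfolding class_K_def by auto
    then show ?thesis by auto
  qed
  then have "g ` {0..} = {0..}"
    using class_K_nonneg[OF class_K_inf_imp_class_K] by auto
  moreover have "inj_on g {0..}"
    using class_K_inf_imp_class_K unfolding class_K_def by (blast intro: strict_mono_on_imp_inj_on)
  ultimately show ?thesis by (simp add: bij_betw_def)
qed

lemma K_inv_apply: "s \<ge> 0 \<Longrightarrow> K_inv g (g s) = s"
  unfolding K_inv_def using class_K_inf_bij_betw by (simp add: bij_betw_def the_inv_into_f_f)

lemma apply_K_inv: "y \<ge> 0 \<Longrightarrow> g (K_inv g y) = y"
  unfolding K_inv_def using class_K_inf_bij_betw by (simp add: bij_betw_def f_the_inv_into_f)

lemma K_inv_nonneg: "y \<ge> 0 \<Longrightarrow> K_inv g y \<ge> 0"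
  using class_K_inf_bij_betw K_inv_apply unfolding bij_betw_def by (metis atLeast_iff imageE)

lemma K_inv_0: "K_inv g 0 = 0"
  using K_inv_apply[of 0] class_K_inf_imp_class_K by (simp add: class_K_def)

lemma K_inv_less_iff: "0 \<le> y \<Longrightarrow> 0 \<le> z \<Longrightarrow> K_inv g y < K_inv g z \<longleftrightarrow> y < z"
  using class_K_less_iff[OF class_K_inf_imp_class_K, of "K_inv g y" "K_inv g z"]
  by (simp add: apply_K_inv K_inv_nonneg)

lemma K_inv_le_iff: "0 \<le> y \<Longrightarrow> 0 \<le> z \<Longrightarrow> K_inv g y \<le> K_inv g z \<longleftrightarrow> y \<le> z"
  using K_inv_less_iff[of z y] by linarith

lemma continuous_on_K_inv: "continuous_on {0..} (K_inv g)"
proof -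
  text \<open>Continuity of monotone functions is available on open sets, hence the extension.\<close>
  define h where "h y = (if y \<ge> 0 then K_inv g y else y)" for y
  have "range h = UNIV"
  proof (intro set_eqI iffI UNIV_I)
    fix x :: real
    have "h (if x \<ge> 0 then g x else x) = x"
      using class_K_nonneg[OF class_K_inf_imp_class_K] by (auto simp: h_def K_inv_apply)
    then show "x \<in> range h" by (metis rangeI)
  qed
  moreover have "h y \<le> h z" if "y \<le> z" for y z
    using that K_inv_nonneg[of z] by (auto simp: h_def K_inv_le_iff)
  ultimately have "continuous_on UNIV h"
    by (intro continuous_onI_mono) auto
  then have "continuous_on {0..} h" by (rule continuous_on_subset) simp
  then show ?thesis by (rule continuous_on_eq) (simp add: h_def)
qed

end

section \<open>The class KLL bound used for stability\<close>

text \<open>This is exponential decay of a Lyapunov function pulled back through its lower bound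
  \<open>g\<close>. The \<open>2\<close> anticipates \<open>norms_le_infdist\<close>; the
  \<open>3\<close> anticipates the recovery of \<open>e\<close> from \<open>x + e\<close> and
  \<open>x\<close>.\<close>

lemma class_KL_K_inv_exp:
  assumes g: "class_K_inf g" and u: "class_K_inf u" and "M > 0" "p > 0"
  shows "class_KL (\<lambda>r s. 3 * K_inv g (M * u (2 * r) * exp (- (p * s))))"
proof -
  note gK = class_K_inf_imp_class_K[OF g] and uK = class_K_inf_imp_class_K[OF u]
  have ucont: "continuous_on {0..} u" and "u 0 = 0"
    using uK unfolding class_K_def by blast+
  have nonneg: "0 \<le> M * u (2 * r) * exp (- (p * s))" if "r \<ge> 0" for r s
    using class_K_nonneg[OF uK, of "2 * r"] that \<open>M > 0\<close> by simp
  have cont: "continuous_on ({0..} \<times> {0..}) (\<lambda>(r, s). 3 * K_inv g (M * u (2 * r) * exp (- (p * s))))"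
    unfolding case_prod_unfold
    by (intro continuous_intros continuous_on_compose2[OF continuous_on_K_inv[OF g]]
        continuous_on_compose2[OF ucont]) (auto simp: nonneg)
  moreover have "class_K (\<lambda>r. 3 * K_inv g (M * u (2 * r) * exp (- (p * s))))" if "s \<ge> 0" for s
    unfolding class_K_def
  proof (intro conjI strict_mono_onI)
    show "continuous_on {0..} (\<lambda>r. 3 * K_inv g (M * u (2 * r) * exp (- (p * s))))"
      by (intro continuous_intros continuous_on_compose2[OF continuous_on_K_inv[OF g]]
        continuous_on_compose2[OF ucont]) (auto simp: nonneg)
    show "3 * K_inv g (M * u (2 * 0) * exp (- (p * s))) = 0"
      by (simp add: \<open>u 0 = 0\<close> K_inv_0[OF g])
    fix r r' :: real assume "r \<in> {0..}" "r' \<in> {0..}" "r < r'"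
    then show "3 * K_inv g (M * u (2 * r) * exp (- (p * s))) < 3 * K_inv g (M * u (2 * r') * exp (- (p * s)))"
      using \<open>M > 0\<close> by (simp add: K_inv_less_iff[OF g] nonneg class_K_less_iff[OF uK])
  qed
  moreover have "antimono_on {0..} (\<lambda>s. 3 * K_inv g (M * u (2 * r) * exp (- (p * s))))" if "r > 0" for r
  proof (rule monotone_onI)
    fix s s' :: real assume "s \<le> s'"
    then have "M * u (2 * r) * exp (- (p * s')) \<le> M * u (2 * r) * exp (- (p * s))"
      using class_K_nonneg[OF uK, of "2 * r"] that \<open>M > 0\<close> \<open>p > 0\<close> by (intro mult_left_mono) auto
    then show "3 * K_inv g (M * u (2 * r) * exp (- (p * s'))) \<le> 3 * K_inv g (M * u (2 * r) * exp (- (p * s)))"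
      using that nonneg by (simp add: K_inv_le_iff[OF g])
  qed
  moreover have "((\<lambda>s. 3 * K_inv g (M * u (2 * r) * exp (- (p * s)))) \<longlongrightarrow> 0) at_top" if "r > 0" for r
  proof -
    have "((\<lambda>s. exp (- (p * s))) \<longlongrightarrow> 0) at_top"
      using \<open>p > 0\<close>
      by (intro filterlim_compose[OF exp_at_bot] filterlim_compose[OF filterlim_uminus_at_bot_at_top]
          filterlim_tendsto_pos_mult_at_top[OF tendsto_const _ filterlim_ident])
    then have "((\<lambda>s. M * u (2 * r) * exp (- (p * s))) \<longlongrightarrow> 0) at_top"
      by (rule tendsto_mult_right_zero)
    then have "((\<lambda>s. K_inv g (M * u (2 * r) * exp (- (p * s)))) \<longlongrightarrow> K_inv g 0) at_top"
      by (rule continuous_on_tendsto_compose[OF continuous_on_K_inv[OF g]])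
        (use that nonneg in auto)
    then show ?thesis
      by (simp add: K_inv_0[OF g] tendsto_mult_right_zero)
  qed
  ultimately show ?thesis
    unfolding class_KL_def by blast
qed

text \<open>Freezing one of the two time arguments turns its exponential into part of the constant
  \<open>M\<close>.\<close>

lemma class_KLL_K_inv_exp:
  assumes g: "class_K_inf g" and u: "class_K_inf u" and "M > 0" "p > 0" "q > 0"
  shows "class_KLL (\<lambda>r s t. 3 * K_inv g (M * u (2 * r) * exp (- (p * s) - q * t)))"
proof -
  have "class_KL (\<lambda>r s. 3 * K_inv g (M * u (2 * r) * exp (- (p * s) - q * t)))" for t
    using class_KL_K_inv_exp[OF g u, of "M * exp (- (q * t))" p] assms
    by (simp add: exp_diff exp_minus divide_inverse mult_ac)
  moreover have "class_KL (\<lambda>r s. 3 * K_inv g (M * u (2 * r) * exp (- (p * t) - q * s)))" for t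
    using class_KL_K_inv_exp[OF g u, of "M * exp (- (p * t))" q] assms
    by (simp add: exp_diff exp_minus divide_inverse mult_ac)
  ultimately show ?thesis
    unfolding class_KLL_def by simp
qed

section \<open>The event-triggered loop\<close>

lemma class_K_inf_linear:
  assumes "a > 0"
  shows "class_K_inf (\<lambda>r. a * r)"
proof -
  have "\<exists>s\<ge>0. a * s > M" for M
    using assms by (intro exI[of _ "(\<bar>M\<bar> + 1) / a"]) auto
  then show ?thesis
    using assms unfolding class_K_inf_def class_K_def
    by (auto intro!: continuous_intros strict_mono_onI)
qed

locale event_triggered_loop =
  fixes \<alpha>bar \<sigma>bar \<epsilon> :: real
    and f :: "real^'n \<Rightarrow> real^'n \<Rightarrow> real^'n"
    and V :: "real^'n \<Rightarrow> real"
    and \<alpha>low \<alpha>up \<gamma> :: "real \<Rightarrow> real"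
  assumes \<alpha>bar: "\<alpha>bar > 0"
    and \<sigma>bar: "\<sigma>bar \<in> {0<..<1}"
    and \<epsilon>: "\<epsilon> \<in> {0<..<1}"
    and smooth_V: "smooth V"
    and \<alpha>low: "class_K_inf \<alpha>low" and \<alpha>up: "class_K_inf \<alpha>up" and \<gamma>: "class_K_inf \<gamma>"
    and V_bounds: "\<alpha>low (norm x) \<le> V x \<and> V x \<le> \<alpha>up (norm x)"
    and V_decay: "frechet_derivative V (at x) (f x e) \<le> - \<alpha>bar * V x + \<gamma> (norm e)"
    and local_linear_growth: "compact (S :: ((real^'n) \<times> (real^'n)) set) \<Longrightarrow>
               \<exists>L1\<ge>0. \<exists>L2\<ge>0. \<forall>(x, e)\<in>S.
                 norm (f x e) \<le> L1 * (norm x + norm e) \<and>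
                 K_inv \<alpha>low (gamma_tilde \<alpha>bar \<sigma>bar \<gamma> (norm e)) \<le> L2 * norm e"
begin

section \<open>Lyapunov function, triggering rule and distance to the attractor\<close>

abbreviation "H \<equiv> etc_system \<alpha>bar \<sigma>bar \<epsilon> f V"

definition "\<A> = {(x :: real^'n, e :: real^'n, \<eta> :: real). (x, e) = (0, 0)}"

definition "rate = \<sigma>bar * \<alpha>bar"

lemma rate_pos: "rate > 0"
  using \<alpha>bar \<sigma>bar by (simp add: rate_def)

lemma V_nonneg: "V x \<ge> 0"
  using V_bounds[of x] class_K_nonneg[OF class_K_inf_imp_class_K[OF \<alpha>low], of "norm x"] by simp

lemma V_zero: "V 0 = 0"
proof -
  have "\<alpha>up 0 = 0"
    using class_K_inf_imp_class_K[OF \<alpha>up] by (simp add: class_K_def)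
  then show ?thesis using V_bounds[of 0] V_nonneg[of 0] by simp
qed

lemma norm_le_K_inv_V:
  assumes "V x \<le> y"
  shows "norm x \<le> K_inv \<alpha>low y"
proof -
  have "K_inv \<alpha>low (\<alpha>low (norm x)) \<le> K_inv \<alpha>low y"
    using V_bounds[of x] V_nonneg[of x] assms
      class_K_nonneg[OF class_K_inf_imp_class_K[OF \<alpha>low], of "norm x"]
    by (simp add: K_inv_le_iff[OF \<alpha>low])
  then show ?thesis by (simp add: K_inv_apply[OF \<alpha>low])
qed

lemma V_le_0_iff: "V x \<le> 0 \<longleftrightarrow> x = 0"
  using norm_le_K_inv_V[of x 0] V_zero by (auto simp: K_inv_0[OF \<alpha>low])

lemma continuous_on_V: "continuous_on UNIV V"
  using smooth_V unfolding smooth_def by (metis class_C.simps(1))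

lemma flow_set_H: "flow_set H = {(x, e, \<eta>). V x \<le> \<eta> * V (x + e) \<and> \<eta> \<in> {\<epsilon>..1}}"
  and flow_map_H: "flow_map H = (\<lambda>(x, e, \<eta>). (f x e, - f x e, - rate))"
  and jump_map_H: "jump_map H = (\<lambda>(x, e, \<eta>). (x, 0, 1))"
  by (simp_all add: etc_system_def rate_def)

lemma closed_flow_set: "closed (flow_set H)"
proof -
  have "flow_set H = {q. V (fst q) \<le> snd (snd q) * V (fst q + fst (snd q))} \<inter>
      {q. \<epsilon> \<le> snd (snd q)} \<inter> {q. snd (snd q) \<le> 1}"
    by (auto simp: flow_set_H)
  then show ?thesis
    by (auto intro!: closed_Int closed_Collect_le continuous_intros
        continuous_on_compose2[OF continuous_on_V])
qed

text \<open>The trigger bounds the derivative of \<open>V\<close> from below and the decay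
  assumption bounds it from above. Together they give \<open>(1 - \<sigma>bar) * \<alpha>bar * V x
  \<le> \<gamma> (norm e)\<close>, and inverting the linear function inside
  \<open>gamma_tilde\<close> is division by \<open>\<alpha>bar\<close>.\<close>

lemma norm_le_of_triggered:
  assumes "frechet_derivative V (at x) (f x e) \<ge> - (\<sigma>bar * \<alpha>bar * V x)"
  shows "norm x \<le> K_inv \<alpha>low (gamma_tilde \<alpha>bar \<sigma>bar \<gamma> (norm e))"
proof (rule norm_le_K_inv_V)
  define y where "y = inverse (1 - \<sigma>bar) * \<gamma> (norm e)"
  have "y \<ge> 0"
    using \<sigma>bar class_K_nonneg[OF class_K_inf_imp_class_K[OF \<gamma>], of "norm e"] by (simp add: y_def)
  have "K_inv (\<lambda>r. \<alpha>bar * r) y = y / \<alpha>bar"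
    using K_inv_apply[OF class_K_inf_linear[OF \<alpha>bar], of "y / \<alpha>bar"] \<open>y \<ge> 0\<close> \<alpha>bar by simp
  moreover have "(1 - \<sigma>bar) * (\<alpha>bar * V x) \<le> \<gamma> (norm e)"
    using assms V_decay[of x e] by (simp add: algebra_simps)
  then have "\<alpha>bar * V x \<le> y"
    using \<sigma>bar by (simp add: y_def field_simps)
  ultimately show "V x \<le> gamma_tilde \<alpha>bar \<sigma>bar \<gamma> (norm e)"
    using \<alpha>bar unfolding gamma_tilde_def y_def[symmetric] by (simp add: pos_le_divide_eq mult.commute[of "V x"])
qed

lemma mem_origin [simp]: "(x, e, \<eta>) \<in> \<A> \<longleftrightarrow> x = 0 \<and> e = 0"
  by (simp add: \<A>_def)

lemma infdist_origin_le: "infdist (x, e, \<eta>) \<A> \<le> norm x + norm e"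
proof -
  have "infdist (x, e, \<eta>) \<A> \<le> dist (x, e, \<eta>) (0, 0, \<eta>)"
    by (rule infdist_le) simp
  also have "\<dots> \<le> norm x + norm e"
    using sqrt_sum_squares_le_sum_abs[of "norm x" "norm e"] by (simp add: dist_Pair_Pair)
  finally show ?thesis .
qed

text \<open>Every point of \<open>\<A>\<close> has zero as its first two components, so each of the
  two norms is at most the distance to it; adding them costs the factor \<open>2\<close>.\<close>

lemma norms_le_infdist: "norm x + norm e \<le> 2 * infdist (x, e, \<eta>) \<A>"
proof -
  have "(0, 0, 0) \<in> \<A>" by simp
  then have "\<A> \<noteq> {}" by blast
  moreover have "(norm x + norm e) / 2 \<le> dist (x, e, \<eta>) a" if a: "a \<in> \<A>" for a
  proof -
    obtain \<eta>' where a: "a = (0, 0, \<eta>')" using a by (cases a) auto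
    have "dist x 0 \<le> dist (x, e, \<eta>) a" "dist e 0 \<le> dist (x, e, \<eta>) a"
      using dist_fst_le[of "(x, e, \<eta>)" a] order_trans[OF dist_fst_le[of "(e, \<eta>)" "snd a"] dist_snd_le[of "(x, e, \<eta>)" a, simplified]]
      by (simp_all add: a)
    then show ?thesis by simp
  qed
  ultimately have "(norm x + norm e) / 2 \<le> infdist (x, e, \<eta>) \<A>"
    unfolding infdist_notempty[OF \<open>\<A> \<noteq> {}\<close>] by (rule cINF_greatest)
  then show ?thesis by simp
qed

text \<open>From \<open>1 + z \<le> exp z\<close>. Unlike the affine bounds, the exponential ones
  multiply to a bound of the same form across jumps.\<close>

lemma decay_factor_le_exp: "\<eta> \<le> 1 - rate * t \<Longrightarrow> \<eta> \<le> exp (- (rate * t))"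
  using exp_ge_add_one_self[of "- (rate * t)"] by linarith

section \<open>Solutions in the coordinates (x, e, eta)\<close>

context
  fixes \<phi> :: "real \<Rightarrow> nat \<Rightarrow> (real^'n) \<times> (real^'n) \<times> real"
begin

definition "X t j = fst (\<phi> t j)"
definition "Err t j = fst (snd (\<phi> t j))"
definition "Eta t j = snd (snd (\<phi> t j))"

lemma state_eq: "\<phi> t j = (X t j, Err t j, Eta t j)"
  by (simp add: X_def Err_def Eta_def)

lemma mem_origin_iff: "\<phi> t j \<in> \<A> \<longleftrightarrow> X t j = 0 \<and> Err t j = 0"
  by (simp add: state_eq)

context
  fixes E
  assumes sol: "hybrid_solution H E \<phi>"
begin

text \<open>The velocities of \<open>x\<close> and \<open>e\<close> cancel and that of the third
  component is constant, so both identities are the case \<open>K = 0\<close> of the increment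
  bound.\<close>

lemma flow_affine:
  assumes "(s, j) \<in> E" and "(u, j) \<in> E" and "s \<le> u"
  shows "X u j + Err u j = X s j + Err s j" and "Eta u j = Eta s j - rate * (u - s)"
proof -
  have "bounded_linear (\<lambda>q :: (real^'n) \<times> (real^'n) \<times> real. fst q + fst (snd q))"
    by (intro bounded_linear_add bounded_linear_fst bounded_linear_compose[OF bounded_linear_fst]
        bounded_linear_snd)
  from hybrid_solution_increment_bound[OF sol assms this, of 0 0]
  show "X u j + Err u j = X s j + Err s j"
    by (simp add: flow_map_H X_def Err_def split_beta)
  have "bounded_linear (\<lambda>q :: (real^'n) \<times> (real^'n) \<times> real. snd (snd q))"
    by (intro bounded_linear_compose[OF bounded_linear_snd] bounded_linear_snd)
  from hybrid_solution_increment_bound[OF sol assms this, of 0 "- rate"]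
  show "Eta u j = Eta s j - rate * (u - s)"
    by (simp add: flow_map_H Eta_def split_beta algebra_simps)
qed

lemma flow_region:
  assumes "(s, j) \<in> E" and "(u, j) \<in> E" and "s < u" and "t \<in> {s..u}"
  shows "V (X t j) \<le> Eta t j * V (X t j + Err t j)" and "\<epsilon> \<le> Eta t j" and "Eta t j \<le> 1"
  using hybrid_solution_mem_flow_set[OF sol assms(1,2,3) closed_flow_set assms(4)]
  by (simp_all add: flow_set_H state_eq)

lemma jump_update:
  assumes "(s, j) \<in> E" and "(s, Suc j) \<in> E"
  shows "X s (Suc j) = X s j" and "Err s (Suc j) = 0" and "Eta s (Suc j) = 1"
  using hybrid_solution_jump(2)[OF sol assms]
  by (simp_all add: jump_map_H X_def Err_def Eta_def split_beta)

lemma jump_condition: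
  assumes "(s, j) \<in> E" and "(s, Suc j) \<in> E"
  shows "frechet_derivative V (at (X s j)) (f (X s j) (Err s j)) \<ge> - (\<sigma>bar * \<alpha>bar * V (X s j))
    \<or> Eta s j = \<epsilon>"
  using hybrid_solution_jump(1)[OF sol assms]
  by (auto simp: etc_system_def state_eq)

text \<open>The jump resets \<open>e\<close> to zero, so \<open>x + e\<close> stays at the value of
  \<open>x\<close> at the jump, and the flow condition compares \<open>V\<close> with its value
  there.\<close>

lemma flow_after_jump:
  assumes "(s, j) \<in> E" and "(s, Suc j) \<in> E" and "(t, Suc j) \<in> E"
  shows "s \<le> t" and "X t (Suc j) + Err t (Suc j) = X s (Suc j)"
    and "Eta t (Suc j) = 1 - rate * (t - s)"
    and "\<epsilon> \<le> Eta t (Suc j)"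
    and "V (X t (Suc j)) \<le> Eta t (Suc j) * V (X s (Suc j))"
proof -
  show "s \<le> t"
    by (rule hybrid_time_domain_jump_le[OF hybrid_solution_time_domain[OF sol] assms])
  note aff = flow_affine[OF assms(2,3) \<open>s \<le> t\<close>] and upd = jump_update[OF assms(1,2)]
  show 1: "X t (Suc j) + Err t (Suc j) = X s (Suc j)" "Eta t (Suc j) = 1 - rate * (t - s)"
    using aff upd by simp_all
  have "V (X t (Suc j)) \<le> Eta t (Suc j) * V (X s (Suc j)) \<and> \<epsilon> \<le> Eta t (Suc j)"
  proof (cases "s = t")
    \<comment> \<open>The flow condition is not guaranteed on a one-point flow interval; the reset
      of the third component to \<open>1\<close> replaces it.\<close>
    case True
    then show ?thesis using \<epsilon> upd by simp
  next
    case False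
    then show ?thesis
      using flow_region[OF assms(2,3), of t] 1 \<open>s \<le> t\<close> by simp
  qed
  then show "V (X t (Suc j)) \<le> Eta t (Suc j) * V (X s (Suc j))" "\<epsilon> \<le> Eta t (Suc j)" by auto
qed

text \<open>No uniqueness of solutions is invoked: \<open>x + e\<close> remains zero, so the flow
  condition itself gives \<open>V x \<le> 0\<close>.\<close>

lemma flow_from_origin:
  assumes "(s, j) \<in> E" and "(u, j) \<in> E" and "s \<le> u" and "\<phi> s j \<in> \<A>"
  shows "\<phi> u j \<in> \<A>"
proof (cases "s = u")
  case False
  have "X u j + Err u j = 0"
    using flow_affine(1)[OF assms(1-3)] assms(4) by (simp add: mem_origin_iff)
  then have "V (X u j) \<le> 0"
    using flow_region(1)[OF assms(1,2), of u] False assms(3) by (simp add: V_zero)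
  with \<open>X u j + Err u j = 0\<close> show ?thesis by (simp add: mem_origin_iff V_le_0_iff)
qed (use assms in simp)

lemma jump_from_origin:
  assumes "(s, j) \<in> E" and "(s, Suc j) \<in> E" and "\<phi> s j \<in> \<A>"
  shows "\<phi> s (Suc j) \<in> \<A>"
  using jump_update[OF assms(1,2)] assms(3) by (simp add: mem_origin_iff)

lemma origin_invariant:
  assumes "\<phi> 0 0 \<in> \<A>"
  shows "(t, j) \<in> E \<Longrightarrow> \<phi> t j \<in> \<A>"
proof (induction j arbitrary: t)
  case 0
  with hybrid_time_domain_0[OF hybrid_solution_time_domain[OF sol] 0] flow_from_origin[of 0 0 t] assms
  show ?case by blast
next
  case (Suc j)
  obtain s where "s \<le> t" "(s, j) \<in> E" "(s, Suc j) \<in> E"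
    using hybrid_time_domain_jump_time[OF hybrid_solution_time_domain[OF sol] Suc.prems] by blast
  with Suc show ?case
    by (meson jump_from_origin flow_from_origin)
qed

text \<open>The first bound is the one that passes from jump to jump. The second controls the error:
  \<open>x + e\<close> is the state at the last jump, and the time since then is less than
  \<open>1 / rate\<close>, which costs one factor \<open>exp 1\<close>.\<close>

lemma V_decay_along_solution:
  assumes W: "\<alpha>up (2 * infdist (\<phi> 0 0) \<A>) \<le> W"
  shows "(t, j) \<in> E \<Longrightarrow> V (X t j) \<le> W * exp (- (rate * t)) \<and>
    V (X t j + Err t j) \<le> W * exp (1 - rate * t)"
proof (induction j arbitrary: t)
  case 0
  have init: "(0, 0) \<in> E" "0 \<le> t"
    using hybrid_time_domain_0[OF hybrid_solution_time_domain[OF sol] 0] by auto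
  have norms: "norm (X 0 0) + norm (Err 0 0) \<le> 2 * infdist (\<phi> 0 0) \<A>"
    using norms_le_infdist[of "X 0 0" "Err 0 0" "Eta 0 0"] by (simp add: state_eq)
  have V_le: "V x \<le> W" if "norm x \<le> norm (X 0 0) + norm (Err 0 0)" for x
  proof -
    have "\<alpha>up (norm x) \<le> \<alpha>up (2 * infdist (\<phi> 0 0) \<A>)"
      using that norms by (intro class_K_mono[OF class_K_inf_imp_class_K[OF \<alpha>up]]) auto
    then show ?thesis using V_bounds[of x] W by simp
  qed
  have W_sum: "V (X 0 0 + Err 0 0) \<le> W"
    by (rule V_le) (rule norm_triangle_ineq)
  then have "W \<ge> 0" using V_nonneg order_trans by blast
  show ?case
  proof (cases "t = 0")
    \<comment> \<open>The initial state may lie outside the flow set, so at time zero only the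
      initial bounds are available.\<close>
    case True
    have "W \<le> W * exp 1" using \<open>W \<ge> 0\<close> by (simp add: mult_le_cancel_left1)
    with True W_sum V_le[of "X 0 0"] show ?thesis by simp
  next
    case False
    then have "0 < t" using init by simp
    \<comment> \<open>The initial value of the third component is unrestricted; a nondegenerate
      first flow interval forces it to be at most \<open>1\<close>.\<close>
    note aff = flow_affine[OF init(1) 0 init(2)]
      and start = flow_region[OF init(1) 0 \<open>0 < t\<close>, of 0]
      and region = flow_region[OF init(1) 0 \<open>0 < t\<close>, of t]
    have "Eta t 0 \<le> exp (- (rate * t))"
      using aff start init by (intro decay_factor_le_exp) simp
    then have "Eta t 0 * V (X 0 0 + Err 0 0) \<le> exp (- (rate * t)) * W"
      using W_sum V_nonneg by (intro mult_mono) auto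
    then have "V (X t 0) \<le> W * exp (- (rate * t))"
      using region aff init by (simp add: mult.commute)
    \<comment> \<open>The third component falls from at most \<open>1\<close> to at least
      \<open>\<epsilon> > 0\<close> at speed \<open>rate\<close>.\<close>
    moreover have "rate * t \<le> 1"
      using aff start region init \<epsilon> by simp
    then have "W * 1 \<le> W * exp (1 - rate * t)"
      using \<open>W \<ge> 0\<close> by (intro mult_left_mono) auto
    then have "V (X t 0 + Err t 0) \<le> W * exp (1 - rate * t)"
      using aff W_sum by simp
    ultimately show ?thesis by blast
  qed
next
  case (Suc j)
  obtain s where s: "s \<le> t" "(s, j) \<in> E" "(s, Suc j) \<in> E"
    using hybrid_time_domain_jump_time[OF hybrid_solution_time_domain[OF sol] Suc.prems] by blast
  note after = flow_after_jump[OF s(2,3) Suc.prems]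
  have Vs: "V (X s (Suc j)) \<le> W * exp (- (rate * s))"
    using Suc.IH[OF s(2)] jump_update[OF s(2,3)] by simp
  then have "W * exp (- (rate * s)) \<ge> 0" using V_nonneg order_trans by blast
  then have "W \<ge> 0" by (simp add: zero_le_mult_iff)
  have "Eta t (Suc j) \<le> exp (- (rate * (t - s)))"
    using after by (intro decay_factor_le_exp) simp
  then have "Eta t (Suc j) * V (X s (Suc j)) \<le> exp (- (rate * (t - s))) * (W * exp (- (rate * s)))"
    using Vs V_nonneg by (intro mult_mono) auto
  also have "\<dots> = W * exp (- (rate * t))"
    by (simp add: algebra_simps flip: exp_add)
  finally have "V (X t (Suc j)) \<le> W * exp (- (rate * t))"
    using after by simp
  moreover have "- (rate * s) \<le> 1 - rate * t"
    using after \<epsilon> by (simp add: algebra_simps)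
  then have "W * exp (- (rate * s)) \<le> W * exp (1 - rate * t)"
    using \<open>W \<ge> 0\<close> by (intro mult_left_mono) auto
  then have "V (X t (Suc j) + Err t (Suc j)) \<le> W * exp (1 - rate * t)"
    using after Vs by simp
  ultimately show ?case by blast
qed

end

end

section \<open>Dwell time\<close>

text \<open>The time depends only on a level \<open>W\<close> of \<open>V\<close> after the earlier
  jump, and only the state there has to avoid \<open>\<A>\<close>. In this form it also counts jumps
  in the stability proof.\<close>

lemma dwell_time_exists:
  obtains \<tau> where "\<tau> > 0"
    and "\<And>E \<phi> j s u. hybrid_solution H E \<phi> \<Longrightarrow> (s, j) \<in> E \<Longrightarrow> (s, Suc j) \<in> E \<Longrightarrow>
      (u, Suc j) \<in> E \<Longrightarrow> (u, Suc (Suc j)) \<in> E \<Longrightarrow> V (X \<phi> s (Suc j)) \<le> W \<Longrightarrow>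
      \<phi> s (Suc j) \<notin> \<A> \<Longrightarrow> \<tau> \<le> u - s"
proof -
  \<comment> \<open>\<open>R\<close> bounds \<open>norm x\<close> wherever
    \<open>V x \<le> W\<close>; the error is a difference of two such states, hence the radius
    \<open>2 * R\<close>.\<close>
  define R where "R = K_inv \<alpha>low W"
  have "compact (cball 0 R \<times> cball 0 (2 * R) :: ((real^'n) \<times> (real^'n)) set)"
    by (intro compact_Times compact_cball)
  from local_linear_growth[OF this]
  obtain L1 L2 where "L1 \<ge> 0" "L2 \<ge> 0"
    and L': "\<forall>(x, e)\<in>cball 0 R \<times> cball 0 (2 * R). norm (f x e) \<le> L1 * (norm x + norm e) \<and>
      K_inv \<alpha>low (gamma_tilde \<alpha>bar \<sigma>bar \<gamma> (norm e)) \<le> L2 * norm e"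
    by blast
  have L: "norm (f x e) \<le> L1 * (norm x + norm e) \<and>
      K_inv \<alpha>low (gamma_tilde \<alpha>bar \<sigma>bar \<gamma> (norm e)) \<le> L2 * norm e"
    if "x \<in> cball 0 R" "e \<in> cball 0 (2 * R)" for x e
    using L' that by blast
  \<comment> \<open>The first entry is the time for the third component to fall from
    \<open>1\<close> to \<open>\<epsilon>\<close>. In the second, \<open>L2 + 3\<close> comes from
    \<open>norm x + norm e \<le> (L2 + 1) * M + 2 * M\<close> with \<open>M\<close> the maximal
    error, and \<open>L1 + 1\<close> keeps the denominator positive.\<close>
  define \<tau> where "\<tau> = min ((1 - \<epsilon>) / rate) (1 / ((L1 + 1) * (L2 + 3)))"
  have "\<tau> > 0"
    using \<epsilon> rate_pos \<open>L1 \<ge> 0\<close> \<open>L2 \<ge> 0\<close> by (simp add: \<tau>_def)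
  moreover
  text \<open>If the trigger fires, the state is dominated by the error, so the error, whose speed is at most
    proportional to its maximum \<open>M\<close> over the flow interval, has to grow from zero to \<open>M\<close>.\<close>
  have "\<tau> \<le> u - s"
    if sol: "hybrid_solution H E \<phi>" and E: "(s, j) \<in> E" "(s, Suc j) \<in> E" "(u, Suc j) \<in> E"
      "(u, Suc (Suc j)) \<in> E" and W: "V (X \<phi> s (Suc j)) \<le> W" and out: "\<phi> s (Suc j) \<notin> \<A>"
    for E \<phi> j s u
  proof (cases "Eta \<phi> u (Suc j) = \<epsilon>")
    case True
    then have "(1 - \<epsilon>) / rate = u - s"
      using flow_after_jump(3)[OF sol E(1-3)] rate_pos by (simp add: field_simps)
    then show ?thesis by (simp add: \<tau>_def)
  next
    case False
    define x\<^sub>s where "x\<^sub>s = X \<phi> s (Suc j)"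
    let ?e = "\<lambda>t. Err \<phi> t (Suc j)"
    note upd = jump_update[OF sol E(1,2)]
    have "x\<^sub>s \<noteq> 0" using out upd by (simp add: mem_origin_iff x\<^sub>s_def)
    have "s \<le> u" by (rule flow_after_jump(1)[OF sol E(1-3)])
    have region: "norm (X \<phi> t (Suc j)) \<le> norm x\<^sub>s + norm (?e t)"
      "norm x\<^sub>s \<le> norm (X \<phi> t (Suc j)) + norm (?e t)"
      "X \<phi> t (Suc j) \<in> cball 0 R" "?e t \<in> cball 0 (2 * R)" if t: "t \<in> {s..u}" for t
    proof -
      have "(t, Suc j) \<in> E"
        using hybrid_time_domain_interval[OF hybrid_solution_time_domain[OF sol] E(2,3)] t by auto
      note after = flow_after_jump[OF sol E(1,2) this]
      have sum: "X \<phi> t (Suc j) + ?e t = x\<^sub>s"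
        using after by (simp add: x\<^sub>s_def)
      then have "X \<phi> t (Suc j) = x\<^sub>s - ?e t" "?e t = x\<^sub>s - X \<phi> t (Suc j)"
        by (simp_all add: algebra_simps)
      then show "norm (X \<phi> t (Suc j)) \<le> norm x\<^sub>s + norm (?e t)"
        and "norm x\<^sub>s \<le> norm (X \<phi> t (Suc j)) + norm (?e t)"
        using norm_triangle_ineq4[of x\<^sub>s "?e t"] norm_triangle_ineq[of "X \<phi> t (Suc j)" "?e t"] sum
        by simp_all
      have "Eta \<phi> t (Suc j) \<le> 1" using after rate_pos by simp
      then have "Eta \<phi> t (Suc j) * V x\<^sub>s \<le> V x\<^sub>s"
        using mult_right_mono[OF _ V_nonneg[of x\<^sub>s], of "Eta \<phi> t (Suc j)" 1] by simp
      then have "V (X \<phi> t (Suc j)) \<le> W"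
        using after W by (simp add: x\<^sub>s_def)
      then have "norm (X \<phi> t (Suc j)) \<le> R" and "norm x\<^sub>s \<le> R"
        using W by (auto simp: R_def x\<^sub>s_def intro: norm_le_K_inv_V)
      then show "X \<phi> t (Suc j) \<in> cball 0 R" "?e t \<in> cball 0 (2 * R)"
        using \<open>?e t = x\<^sub>s - X \<phi> t (Suc j)\<close> norm_triangle_ineq4[of x\<^sub>s "X \<phi> t (Suc j)"] by auto
    qed
    have err: "bounded_linear (\<lambda>q :: (real^'n) \<times> (real^'n) \<times> real. fst (snd q))"
      by (intro bounded_linear_compose[OF bounded_linear_fst] bounded_linear_snd)
    have "continuous_on {s..u} (\<lambda>t. norm (?e t))"
      unfolding Err_def
      using abs_continuous_on_imp_continuous_on[OF hybrid_solution_abs_continuous_on[OF sol E(2,3)]]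
      by (intro continuous_intros)
    then obtain v where v: "v \<in> {s..u}" and max: "\<And>t. t \<in> {s..u} \<Longrightarrow> norm (?e t) \<le> norm (?e v)"
      using continuous_attains_sup[of "{s..u}" "\<lambda>t. norm (?e t)"] \<open>s \<le> u\<close> by auto
    define M where "M = norm (?e v)"
    have "norm (X \<phi> u (Suc j)) \<le> K_inv \<alpha>low (gamma_tilde \<alpha>bar \<sigma>bar \<gamma> (norm (?e u)))"
      by (rule norm_le_of_triggered) (use jump_condition[OF sol E(3,4)] False in simp)
    also have "\<dots> \<le> L2 * norm (?e u)"
      using L[OF region(3,4)[of u]] \<open>s \<le> u\<close> by simp
    finally have "norm (X \<phi> u (Suc j)) \<le> L2 * norm (?e u)" .
    then have "norm x\<^sub>s \<le> (L2 + 1) * norm (?e u)"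
      using region(2)[of u] \<open>s \<le> u\<close> by (simp add: algebra_simps)
    also have "\<dots> \<le> (L2 + 1) * M"
      using max[of u] \<open>s \<le> u\<close> \<open>L2 \<ge> 0\<close> by (intro mult_left_mono) (auto simp: M_def)
    finally have x\<^sub>s_le: "norm x\<^sub>s \<le> (L2 + 1) * M" .
    \<comment> \<open>This is where starting outside \<open>\<A>\<close> enters: the error is zero
      after the jump, so the state \<open>x\<^sub>s\<close> is not. Positivity allows the later
      cancellation of \<open>M\<close>.\<close>
    have "M \<noteq> 0" using x\<^sub>s_le \<open>x\<^sub>s \<noteq> 0\<close> by auto
    then have "M > 0" by (simp add: M_def)
    define K where "K = (L1 + 1) * ((L2 + 3) * M)"
    have "K \<ge> 0" using \<open>L1 \<ge> 0\<close> \<open>L2 \<ge> 0\<close> \<open>M > 0\<close> by (simp add: K_def)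
    have "norm (- f (X \<phi> t (Suc j)) (?e t)) \<le> K" if t: "t \<in> {s..u}" for t
    proof -
      have "norm (f (X \<phi> t (Suc j)) (?e t)) \<le> L1 * (norm (X \<phi> t (Suc j)) + norm (?e t))"
        using L region(3,4)[OF t] by blast
      also have "\<dots> \<le> (L1 + 1) * ((L2 + 3) * M)"
      proof (rule mult_mono)
        have "norm (X \<phi> t (Suc j)) + norm (?e t) \<le> (L2 + 1) * M + 2 * M"
          using region(1)[OF t] max[OF t] x\<^sub>s_le by (simp add: M_def)
        then show "norm (X \<phi> t (Suc j)) + norm (?e t) \<le> (L2 + 3) * M"
          by (simp add: algebra_simps)
      qed (use \<open>L1 \<ge> 0\<close> in auto)
      finally show ?thesis by (simp add: K_def)
    qed
    moreover have "(v, Suc j) \<in> E"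
      using hybrid_time_domain_interval[OF hybrid_solution_time_domain[OF sol] E(2,3)] v by auto
    ultimately have "norm (?e v - ?e s) \<le> K * (v - s)"
      using hybrid_solution_increment_bound[OF sol E(2) _ _ err \<open>K \<ge> 0\<close>, of v 0] v
      by (simp add: flow_map_H Err_def X_def split_beta)
    also have "\<dots> \<le> K * (u - s)"
      using v \<open>K \<ge> 0\<close> by (intro mult_left_mono) auto
    finally have "1 * M \<le> ((L1 + 1) * (L2 + 3) * (u - s)) * M"
      using upd by (simp add: M_def K_def mult_ac)
    then have "1 \<le> (L1 + 1) * (L2 + 3) * (u - s)"
      using \<open>M > 0\<close> by (simp only: mult_le_cancel_right_pos)
    moreover have "(L1 + 1) * (L2 + 3) > 0" using \<open>L1 \<ge> 0\<close> \<open>L2 \<ge> 0\<close> by simp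
    ultimately have "1 / ((L1 + 1) * (L2 + 3)) \<le> u - s"
      by (simp only: pos_divide_le_eq mult.commute[of "u - s"])
    then show ?thesis by (simp add: \<tau>_def)
  qed
  ultimately show ?thesis by (rule that)
qed

text \<open>Supplies \<open>dwell_time_exists\<close> at every jump with a level that depends on
  \<open>\<Delta>\<close> alone.\<close>

lemma V_le_along_solution:
  assumes "hybrid_solution H E \<phi>" and "infdist (\<phi> 0 0) \<A> \<le> \<Delta>" and "(t, j) \<in> E"
  shows "V (X \<phi> t j) \<le> \<alpha>up (2 * \<Delta>)"
proof -
  note \<alpha>upK = class_K_inf_imp_class_K[OF \<alpha>up]
  have "(0::real) \<le> t"
    using assms(3) hybrid_solution_time_domain[OF assms(1)] unfolding hybrid_time_domain_def by auto
  then have "exp (- (rate * t)) \<le> 1" using rate_pos by simp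
  have "\<alpha>up (2 * infdist (\<phi> 0 0) \<A>) \<le> \<alpha>up (2 * \<Delta>)"
    using assms(2) by (intro class_K_mono[OF \<alpha>upK]) (auto simp: infdist_nonneg)
  moreover have "0 \<le> \<alpha>up (2 * infdist (\<phi> 0 0) \<A>)"
    by (intro class_K_nonneg[OF \<alpha>upK]) (simp add: infdist_nonneg)
  ultimately have "V (X \<phi> t j) \<le> \<alpha>up (2 * \<Delta>) * exp (- (rate * t))" "0 \<le> \<alpha>up (2 * \<Delta>)"
    using V_decay_along_solution[OF assms(1) _ assms(3)] by auto
  then show ?thesis
    using \<open>exp (- (rate * t)) \<le> 1\<close> mult_left_mono[of "exp (- (rate * t))" 1 "\<alpha>up (2 * \<Delta>)"] by simp
qed

lemma semiglobal_dwell_time_origin: "semiglobal_dwell_time H \<A>"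
  unfolding semiglobal_dwell_time_def
proof (intro conjI allI impI)
  show "forward_invariant H \<A>"
    unfolding forward_invariant_def using origin_invariant by blast
  fix \<Delta> :: real
  obtain \<tau> where \<tau>: "\<tau> > 0" "\<And>E \<phi> j s u. hybrid_solution H E \<phi> \<Longrightarrow> (s, j) \<in> E \<Longrightarrow> (s, Suc j) \<in> E \<Longrightarrow>
      (u, Suc j) \<in> E \<Longrightarrow> (u, Suc (Suc j)) \<in> E \<Longrightarrow> V (X \<phi> s (Suc j)) \<le> \<alpha>up (2 * \<Delta>) \<Longrightarrow>
      \<phi> s (Suc j) \<notin> \<A> \<Longrightarrow> \<tau> \<le> u - s"
    by (rule dwell_time_exists[of "\<alpha>up (2 * \<Delta>)"], rule that)
  show "\<exists>\<tau>>0. \<forall>E \<phi>. hybrid_solution H E \<phi> \<and> infdist (\<phi> 0 0) \<A> \<le> \<Delta> \<longrightarrow>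
      (\<forall>j s u. (s, j) \<in> E \<and> (s, Suc j) \<in> E \<and> (u, Suc j) \<in> E \<and> (u, Suc (Suc j)) \<in> E \<and>
         (\<forall>t\<in>{s..u}. \<phi> t (Suc j) \<notin> \<A>) \<longrightarrow> u - s \<ge> \<tau>)"
  proof (intro exI[of _ \<tau>] conjI allI impI \<open>\<tau> > 0\<close>, elim conjE)
    fix E \<phi> j s u
    assume sol: "hybrid_solution H E \<phi>" "infdist (\<phi> 0 0) \<A> \<le> \<Delta>"
      and E: "(s, j) \<in> E" "(s, Suc j) \<in> E" "(u, Suc j) \<in> E" "(u, Suc (Suc j)) \<in> E"
      and out: "\<forall>t\<in>{s..u}. \<phi> t (Suc j) \<notin> \<A>"
    have "s \<le> u" by (rule flow_after_jump(1)[OF sol(1) E(1-3)])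
    then show "\<tau> \<le> u - s"
      using \<tau>(2)[OF sol(1) E V_le_along_solution[OF sol E(2)]] out by simp
  qed
qed

section \<open>Semiglobal asymptotic stability\<close>

lemma S_GAS_origin: "S_GAS H \<A>"
  unfolding S_GAS_def
proof (intro conjI allI impI)
  have "\<A> = {0} \<times> {0} \<times> UNIV" by (auto simp: \<A>_def)
  moreover have "closed ({0 :: real^'n} \<times> {0 :: real^'n} \<times> (UNIV :: real set))"
    by (intro closed_Times) auto
  ultimately show "closed \<A>" by simp
  fix \<Delta> :: real
  obtain \<tau> where \<tau>: "\<tau> > 0" "\<And>E \<phi> j s u. hybrid_solution H E \<phi> \<Longrightarrow> (s, j) \<in> E \<Longrightarrow> (s, Suc j) \<in> E \<Longrightarrow>
      (u, Suc j) \<in> E \<Longrightarrow> (u, Suc (Suc j)) \<in> E \<Longrightarrow> V (X \<phi> s (Suc j)) \<le> \<alpha>up (2 * \<Delta>) \<Longrightarrow>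
      \<phi> s (Suc j) \<notin> \<A> \<Longrightarrow> \<tau> \<le> u - s"
    by (rule dwell_time_exists[of "\<alpha>up (2 * \<Delta>)"], rule that)
  \<comment> \<open>Half of the decay rate is kept for \<open>t\<close>; the other half pays for
    \<open>j\<close> through \<open>real j * \<tau> \<le> t + \<tau>\<close>. In the constant
    \<open>exp (1 + p * \<tau>)\<close>, the \<open>1\<close> comes from the bound on
    \<open>V (x + e)\<close> and \<open>p * \<tau>\<close> from the extra
    \<open>\<tau>\<close>.\<close>
  define p where "p = rate / 2"
  define \<beta> where "\<beta> = (\<lambda>r s t. 3 * K_inv \<alpha>low (exp (1 + p * \<tau>) * \<alpha>up (2 * r) * exp (- (p * s) - (p * \<tau>) * t)))"
  have "p > 0" using rate_pos by (simp add: p_def)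
  then have "class_KLL \<beta>"
    unfolding \<beta>_def using \<tau>(1) by (intro class_KLL_K_inv_exp \<alpha>low \<alpha>up) simp_all
  moreover have "infdist (\<phi> t j) \<A> \<le> \<beta> (infdist (\<phi> 0 0) \<A>) t (real j)"
    if sol: "hybrid_solution H E \<phi>" "infdist (\<phi> 0 0) \<A> \<le> \<Delta>" and tj: "(t, j) \<in> E" for E \<phi> t j
  proof -
    define r where "r = infdist (\<phi> 0 0) \<A>"
    define Y where "Y = exp (1 + p * \<tau>) * \<alpha>up (2 * r) * exp (- (p * t) - (p * \<tau>) * real j)"
    have "\<alpha>up (2 * r) \<ge> 0"
      by (intro class_K_nonneg[OF class_K_inf_imp_class_K[OF \<alpha>up]]) (simp add: r_def infdist_nonneg)
    then have "Y \<ge> 0" by (simp add: Y_def)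
    note dom = hybrid_solution_time_domain[OF sol(1)]
    \<comment> \<open>The first jump may happen at time zero, so the jump to index
      \<open>Suc i\<close> is only preceded by \<open>i\<close> dwell times. Being outside
      \<open>\<A>\<close> propagates back to earlier jumps because flows and jumps both preserve
      \<open>\<A>\<close>.\<close>
    have jumps: "real i * \<tau> \<le> s" if "(s, i) \<in> E" "(s, Suc i) \<in> E" "\<phi> s (Suc i) \<notin> \<A>" for s i
      using that
    proof (induction i arbitrary: s)
      case 0
      then show ?case using hybrid_time_domain_0[OF dom] by auto
    next
      case (Suc i)
      obtain s' where s': "s' \<le> s" "(s', i) \<in> E" "(s', Suc i) \<in> E"
        using hybrid_time_domain_jump_time[OF dom Suc.prems(1)] by blast
      have out: "\<phi> s' (Suc i) \<notin> \<A>"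
        using flow_from_origin[OF sol(1) s'(3) Suc.prems(1) s'(1)] jump_from_origin[OF sol(1) Suc.prems(1,2)]
          Suc.prems(3) by blast
      have "\<tau> \<le> s - s'"
        by (rule \<tau>(2)[OF sol(1) s'(2,3) Suc.prems(1,2) V_le_along_solution[OF sol s'(3)] out])
      with Suc.IH[OF s'(2,3) out] show ?case by (simp add: algebra_simps)
    qed
    show ?thesis
    proof (cases "\<phi> t j \<in> \<A>")
      \<comment> \<open>Inside \<open>\<A>\<close> jumps may repeat without delay, but the distance
        is zero and the bound is nonnegative.\<close>
      case True
      then have "infdist (\<phi> t j) \<A> = 0" by simp
      then show ?thesis
        using K_inv_nonneg[OF \<alpha>low \<open>Y \<ge> 0\<close>] by (simp add: \<beta>_def Y_def r_def)
    next
      case False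
      have "real j * \<tau> \<le> t + \<tau>"
      proof (cases j)
        case 0
        then show ?thesis using hybrid_time_domain_0[OF dom] tj \<tau>(1) by auto
      next
        case (Suc i)
        obtain s where s: "s \<le> t" "(s, i) \<in> E" "(s, Suc i) \<in> E"
          using hybrid_time_domain_jump_time[OF dom, of t i] tj Suc by blast
        then have "\<phi> s (Suc i) \<notin> \<A>"
          using flow_from_origin[OF sol(1) s(3) _ s(1)] tj Suc False by blast
        with jumps[OF s(2,3)] s(1) Suc show ?thesis by (simp add: algebra_simps)
      qed
      then have "p * (real j * \<tau>) \<le> p * (t + \<tau>)"
        using \<open>p > 0\<close> by (intro mult_left_mono) auto
      then have exps: "1 - rate * t \<le> (1 + p * \<tau>) + (- (p * t) - (p * \<tau>) * real j)"
        by (simp add: p_def algebra_simps)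
      have le_Y: "\<alpha>up (2 * r) * exp z \<le> Y" if "z \<le> 1 - rate * t" for z
      proof -
        have *: "exp z \<le> exp (1 + p * \<tau>) * exp (- (p * t) - (p * \<tau>) * real j)"
          using that exps by (simp flip: exp_add)
        show ?thesis
          using mult_left_mono[OF * \<open>\<alpha>up (2 * r) \<ge> 0\<close>]
          by (simp only: Y_def mult.assoc mult.left_commute[of "\<alpha>up (2 * r)"])
      qed
      have "V (X \<phi> t j) \<le> Y" "V (X \<phi> t j + Err \<phi> t j) \<le> Y"
        using V_decay_along_solution[OF sol(1) _ tj, of "\<alpha>up (2 * r)"] le_Y[of "- (rate * t)"]
          le_Y[of "1 - rate * t"] by (simp_all add: r_def)
      \<comment> \<open>Writing \<open>e\<close> as \<open>(x + e) - x\<close> bounds the sum of the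
        norms of \<open>x\<close> and \<open>e\<close> by three times
        \<open>K_inv \<alpha>low Y\<close>.\<close>
      then have "norm (X \<phi> t j) \<le> K_inv \<alpha>low Y" "norm (X \<phi> t j + Err \<phi> t j) \<le> K_inv \<alpha>low Y"
        by (auto intro: norm_le_K_inv_V)
      moreover have "norm (Err \<phi> t j) \<le> norm (X \<phi> t j + Err \<phi> t j) + norm (X \<phi> t j)"
        using norm_triangle_ineq4[of "X \<phi> t j + Err \<phi> t j" "X \<phi> t j"] by simp
      moreover have "infdist (\<phi> t j) \<A> \<le> norm (X \<phi> t j) + norm (Err \<phi> t j)"
        unfolding state_eq[of \<phi> t j] by (rule infdist_origin_le)
      ultimately show ?thesis by (simp add: \<beta>_def Y_def r_def)
    qed
  qed
  ultimately show "\<exists>\<beta>. class_KLL \<beta> \<and> (\<forall>E \<phi>. hybrid_solution H E \<phi> \<and> infdist (\<phi> 0 0) \<A> \<le> \<Delta> \<longrightarrow>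
      (\<forall>(t, j)\<in>E. infdist (\<phi> t j) \<A> \<le> \<beta> (infdist (\<phi> 0 0) \<A>) t (real j)))"
    by blast
qed

end

theorem theorem2:
  fixes \<alpha>bar \<sigma>bar \<epsilon> :: real
    and f :: "real^'n \<Rightarrow> real^'n \<Rightarrow> real^'n"
    and V :: "real^'n \<Rightarrow> real"
    and \<alpha>low \<alpha>up \<gamma> :: "real \<Rightarrow> real"
  assumes "\<alpha>bar > 0"
    and "\<sigma>bar \<in> {0<..<1}"
    and "\<epsilon> \<in> {0<..<1}"
    and "continuous_on UNIV (\<lambda>(x, e). f x e)"
    and A1_smooth: "smooth V"
    and A1_K: "class_K_inf \<alpha>low" "class_K_inf \<alpha>up" "class_K_inf \<gamma>"
    and A1_bounds: "\<And>x. \<alpha>low (norm x) \<le> V x \<and> V x \<le> \<alpha>up (norm x)"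
    and A1_decay: "\<And>x e. frechet_derivative V (at x) (f x e) \<le> - \<alpha>bar * V x + \<gamma> (norm e)"
    and A2: "\<And>S :: ((real^'n) \<times> (real^'n)) set. compact S \<Longrightarrow>
               \<exists>L1\<ge>0. \<exists>L2\<ge>0. \<forall>(x, e)\<in>S.
                 norm (f x e) \<le> L1 * (norm x + norm e) \<and>
                 K_inv \<alpha>low (gamma_tilde \<alpha>bar \<sigma>bar \<gamma> (norm e)) \<le> L2 * norm e"
  shows "S_GAS (etc_system \<alpha>bar \<sigma>bar \<epsilon> f V) {(x, e, \<eta>). (x, e) = (0, 0)} \<and>
         semiglobal_dwell_time (etc_system \<alpha>bar \<sigma>bar \<epsilon> f V) {(x, e, \<eta>). (x, e) = (0, 0)}"
proof -
  interpret event_triggered_loop \<alpha>bar \<sigma>bar \<epsilon> f V \<alpha>low \<alpha>up \<gamma>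
    by (rule event_triggered_loop.intro) (fact assms)+
  show ?thesis
    using S_GAS_origin semiglobal_dwell_time_origin unfolding \<A>_def by blast
qed

end
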